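(* Let $p\in[1/2,1]$, let $k\ge1$, and consider either the real symmetric Toeplitz ensemble or the singly palindromic real symmetric Toeplitz ensemble. For each pairing $c$ of the $2k$ vertices $1,\dots,2k$ on a circle, let $x(c)$ denote the contribution of $c$ to the $2k$-th moment in the unsigned case. Then the contribution of $c$ in the signed case is $$x(c)\,(2p-1)^{e(c)},$$ where $e(c)$ is the number of vertices belonging to crossing pairs of $c$.
   Context: Ensembles. $A=(a_{ij})_{1\le i,j\le N}$ with $a_{ij}=b_{|i-j|}$. In the Toeplitz ensemble $b_0,\dots,b_{N-1}$ are i.i.d. with mean $0$, variance $1$ and finite higher moments; in the singly palindromic Toeplitz ensemble in addition $b_s=b_{N-1-s}$ for $0\le s\le N-1$, the $b_s$ being otherwise i.i.d. as before. The signed ensemble consists of the matrices $(\epsilon_{ij}a_{ij})$ where $\epsilon_{ij}=\epsilon_{ji}\in\{1,-1\}$, the $\epsilon_{ij}$ with $i\le j$ are independent of each other and of $A$, and $\mathrm{Prob}(\epsilon_{ij}=1)=p$. Moments. The expected $2k$-th moment of the rescaled empirical spectral measure (eigenvalues divided by $\sqrt N$) of the signed ensemble is $$\frac1{N^{k+1}}\sum_{1\le i_1,\dots,i_{2k}\le N}\mathbb{E}\big(\epsilon_{i_1i_2}b_{|i_1-i_2|}\,\epsilon_{i_2i_3}b_{|i_2-i_3|}\cdots\epsilon_{i_{2k}i_1}b_{|i_{2k}-i_1|}\big),$$ and the same without the $\epsilon$'s for the unsigned ensemble. Pairings and contributions. A pairing $c$ of the vertices $1,\dots,2k$, placed in this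 order clockwise on a circle, is a partition of them into two-element sets; vertex $j$ corresponds to the factor with indices $(i_j,i_{j+1})$, with $i_{2k+1}=i_1$. Let $T_N(c)$ be the set of tuples $(i_1,\dots,i_{2k})\in\{1,\dots,N\}^{2k}$ such that (a) for $j\ne l$, $b_{|i_j-i_{j+1}|}$ and $b_{|i_l-i_{l+1}|}$ are the same random variable if and only if $\{j,l\}\in c$, and (b) for each $\{j,l\}\in c$ one has, in the Toeplitz case, $i_j-i_{j+1}=-(i_l-i_{l+1})$, and in the singly palindromic case $i_j-i_{j+1}=-(i_l-i_{l+1})+Q$ for some $Q\in\{-(N-1),0,N-1\}$. The contribution of $c$ in the unsigned (resp. signed) case is the limit as $N\to\infty$ of $N^{-(k+1)}$ times the sum over the tuples in $T_N(c)$ of $\mathbb{E}(b_{|i_1-i_2|}\cdots b_{|i_{2k}-i_1|})$ (resp. $\mathbb{E}(\epsilon_{i_1i_2}b_{|i_1-i_2|}\cdots\epsilon_{i_{2k}i_1}b_{|i_{2k}-i_1|})$). A pair $\{a,b\}$ of $c$ is crossing if there is a pair $\{x,y\}$ of $c$ such that, travelling clockwise around the circle, the four vertices appear in the cyclic order $a,x,b,y$. *)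

theory Defs
  imports "HOL-Probability.Probability" "HOL-Library.Disjoint_Sets"
begin

section \<open>The two ensembles\<close>

datatype ensemble = Toeplitz | Palindromic

locale identically_distributed_diagonals = prob_space M for M :: "'a measure" +
  fixes N :: nat and b :: "nat \<Rightarrow> 'a \<Rightarrow> real"
  assumes random_variable_b: "s < N \<Longrightarrow> random_variable borel (b s)"
    and identically_distributed_b:
      "\<lbrakk>s < N; t < N\<rbrakk> \<Longrightarrow> distr M borel (b s) = distr M borel (b t)"
    and finite_moments_b: "s < N \<Longrightarrow> integrable M (\<lambda>\<omega>. b s \<omega> ^ m)"
    and mean_b: "s < N \<Longrightarrow> expectation (b s) = 0"
    and variance_b: "s < N \<Longrightarrow> variance (b s) = 1"

locale toeplitz_ensemble = identically_distributed_diagonals +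
  assumes independent_b: "indep_vars (\<lambda>_. borel) b {..<N}"

text \<open>
  Under the palindromic symmetry the indices \<open>s\<close> with \<open>s \<le> N - 1 - s\<close> represent each
  diagonal variable exactly once.
\<close>

locale palindromic_ensemble = identically_distributed_diagonals +
  assumes palindromic_b:
      "\<lbrakk>s < N; \<omega> \<in> space M\<rbrakk> \<Longrightarrow> b s \<omega> = b (N - 1 - s) \<omega>"
    and independent_b: "indep_vars (\<lambda>_. borel) b {s. s < N \<and> s \<le> N - 1 - s}"

fun diagonal_ensemble ::
    "ensemble \<Rightarrow> 'a measure \<Rightarrow> nat \<Rightarrow> (nat \<Rightarrow> 'a \<Rightarrow> real) \<Rightarrow> bool" where
  "diagonal_ensemble Toeplitz M N b = toeplitz_ensemble M N b"
| "diagonal_ensemble Palindromic M N b = palindromic_ensemble M N b"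

definition toeplitz_matrix :: "(nat \<Rightarrow> 'a \<Rightarrow> real) \<Rightarrow> nat \<Rightarrow> nat \<Rightarrow> 'a \<Rightarrow> real" where
  "toeplitz_matrix b i j = b (nat \<bar>int i - int j\<bar>)"

locale random_signs = prob_space M for M :: "'a measure" +
  fixes N :: nat and A :: "nat \<Rightarrow> nat \<Rightarrow> 'a \<Rightarrow> real"
    and p :: real and \<epsilon> :: "nat \<Rightarrow> nat \<Rightarrow> 'a \<Rightarrow> real"
  assumes sign_symmetric:
      "\<lbrakk>i \<in> {1..N}; j \<in> {1..N}; \<omega> \<in> space M\<rbrakk> \<Longrightarrow> \<epsilon> i j \<omega> = \<epsilon> j i \<omega>"
    and sign_values:
      "\<lbrakk>i \<in> {1..N}; j \<in> {1..N}; \<omega> \<in> space M\<rbrakk> \<Longrightarrow> \<epsilon> i j \<omega> \<in> {1, -1}"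
    and sign_prob:
      "\<lbrakk>i \<in> {1..N}; j \<in> {1..N}\<rbrakk> \<Longrightarrow> prob {\<omega> \<in> space M. \<epsilon> i j \<omega> = 1} = p"
    and signs_independent:
      "indep_vars (\<lambda>_. borel) (\<lambda>(i, j). \<epsilon> i j) {(i, j). 1 \<le> i \<and> i \<le> j \<and> j \<le> N}"
    and signs_independent_of_matrix:
      "indep_var
        (Pi\<^sub>M {(i, j). 1 \<le> i \<and> i \<le> j \<and> j \<le> N} (\<lambda>_. borel))
        (\<lambda>\<omega>. restrict (\<lambda>(i, j). \<epsilon> i j \<omega>) {(i, j). 1 \<le> i \<and> i \<le> j \<and> j \<le> N})
        (Pi\<^sub>M ({1..N} \<times> {1..N}) (\<lambda>_. borel))
        (\<lambda>\<omega>. restrict (\<lambda>(i, j). A i j \<omega>) ({1..N} \<times> {1..N}))"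

definition signed_matrix ::
    "(nat \<Rightarrow> nat \<Rightarrow> 'a \<Rightarrow> real) \<Rightarrow> (nat \<Rightarrow> nat \<Rightarrow> 'a \<Rightarrow> real) \<Rightarrow> nat \<Rightarrow> nat \<Rightarrow> 'a \<Rightarrow> real" where
  "signed_matrix \<epsilon> A i j \<omega> = \<epsilon> i j \<omega> * A i j \<omega>"


section \<open>Pairings and crossings\<close>

definition is_pairing :: "nat \<Rightarrow> nat set set \<Rightarrow> bool" where
  "is_pairing k c \<longleftrightarrow> partition_on {1..2 * k} c \<and> (\<forall>P\<in>c. card P = 2)"

text \<open>
  The vertices carry their labels clockwise, so distinct vertices are met in a given cyclic
  order exactly if some rotation of the sequence of labels is increasing.
\<close>

definition clockwise :: "nat \<Rightarrow> nat \<Rightarrow> nat \<Rightarrow> nat \<Rightarrow> bool" where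
  "clockwise u v w z \<longleftrightarrow>
     (u < v \<and> v < w \<and> w < z) \<or> (v < w \<and> w < z \<and> z < u) \<or>
     (w < z \<and> z < u \<and> u < v) \<or> (z < u \<and> u < v \<and> v < w)"

definition crossing_pair :: "nat set set \<Rightarrow> nat set \<Rightarrow> bool" where
  "crossing_pair c P \<longleftrightarrow>
     P \<in> c \<and> (\<exists>a b x y. P = {a, b} \<and> {x, y} \<in> c \<and> clockwise a x b y)"

definition crossing_vertices :: "nat set set \<Rightarrow> nat set" where
  "crossing_vertices c = \<Union>{P. crossing_pair c P}"


section \<open>Contributions\<close>

definition next_vertex :: "nat \<Rightarrow> nat \<Rightarrow> nat" where
  "next_vertex k j = (if j = 2 * k then 1 else j + 1)"

definition index_diff :: "nat \<Rightarrow> (nat \<Rightarrow> nat) \<Rightarrow> nat \<Rightarrow> int" where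
  "index_diff k i j = int (i j) - int (i (next_vertex k j))"

definition same_rv :: "'a measure \<Rightarrow> ('a \<Rightarrow> real) \<Rightarrow> ('a \<Rightarrow> real) \<Rightarrow> bool" where
  "same_rv M X Y \<longleftrightarrow> (\<forall>\<omega>\<in>space M. X \<omega> = Y \<omega>)"

fun opposite_diffs :: "ensemble \<Rightarrow> nat \<Rightarrow> int \<Rightarrow> int \<Rightarrow> bool" where
  "opposite_diffs Toeplitz N d d' \<longleftrightarrow> d = - d'"
| "opposite_diffs Palindromic N d d' \<longleftrightarrow>
     (\<exists>Q \<in> {- (int N - 1), 0, int N - 1}. d = - d' + Q)"

definition pairing_tuples ::
    "ensemble \<Rightarrow> 'a measure \<Rightarrow> (nat \<Rightarrow> 'a \<Rightarrow> real) \<Rightarrow> nat \<Rightarrow> nat set set \<Rightarrow> nat \<Rightarrow> (nat \<Rightarrow> nat) set"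
  where
  "pairing_tuples E M b k c N =
     {i \<in> {1..2 * k} \<rightarrow>\<^sub>E {1..N}.
        (\<forall>j\<in>{1..2 * k}. \<forall>l\<in>{1..2 * k}. j \<noteq> l \<longrightarrow>
           (same_rv M (b (nat \<bar>index_diff k i j\<bar>)) (b (nat \<bar>index_diff k i l\<bar>)) \<longleftrightarrow>
             {j, l} \<in> c)) \<and>
        (\<forall>j l. {j, l} \<in> c \<longrightarrow> opposite_diffs E N (index_diff k i j) (index_diff k i l))}"

text \<open>
  The normalised sum whose limit is the contribution, for a set \<open>T\<close> of index tuples and a
  random matrix \<open>A\<close>.
\<close>

definition normalised_sum ::
    "'a measure \<Rightarrow> (nat \<Rightarrow> nat \<Rightarrow> 'a \<Rightarrow> real) \<Rightarrow> nat \<Rightarrow> nat \<Rightarrow> (nat \<Rightarrow> nat) set \<Rightarrow> real" where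
  "normalised_sum M A k N T =
     (\<Sum>i\<in>T. \<integral>\<omega>. (\<Prod>j\<in>{1..2 * k}. A (i j) (i (next_vertex k j)) \<omega>) \<partial>M) / real N ^ (k + 1)"

definition has_unsigned_contribution ::
    "ensemble \<Rightarrow> (nat \<Rightarrow> 'a measure) \<Rightarrow> (nat \<Rightarrow> nat \<Rightarrow> 'a \<Rightarrow> real) \<Rightarrow>
     nat \<Rightarrow> nat set set \<Rightarrow> real \<Rightarrow> bool" where
  "has_unsigned_contribution E M b k c x \<longleftrightarrow>
     (\<lambda>N. normalised_sum (M N) (toeplitz_matrix (b N)) k N
            (pairing_tuples E (M N) (b N) k c N)) \<longlonglongrightarrow> x"

definition has_signed_contribution ::
    "ensemble \<Rightarrow> (nat \<Rightarrow> 'a measure) \<Rightarrow> (nat \<Rightarrow> nat \<Rightarrow> 'a \<Rightarrow> real) \<Rightarrow>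
     (nat \<Rightarrow> nat \<Rightarrow> nat \<Rightarrow> 'a \<Rightarrow> real) \<Rightarrow> nat \<Rightarrow> nat set set \<Rightarrow> real \<Rightarrow> bool" where
  "has_signed_contribution E M b \<epsilon> k c x \<longleftrightarrow>
     (\<lambda>N. normalised_sum (M N) (signed_matrix (\<epsilon> N) (toeplitz_matrix (b N))) k N
            (pairing_tuples E (M N) (b N) k c N)) \<longlonglongrightarrow> x"

end

theory Submission imports Defs begin

text \<open>
  For a tuple in \<open>pairing_tuples\<close> the unsigned expectation is a product of second moments of
  distinct independent variables, hence \<open>1\<close>, so the unsigned contribution is a limit of normalised
  tuple counts. Up to \<open>O(N ^ k)\<close> tuples, these are the tuples satisfying the pair equations alone,
  which are the lattice points of finitely many dilated polytopes in \<open>k + 1\<close> parameters: the first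
  index and one difference per pair. In the signed case the sign variables of a pair cancel if its
  two matrix entries coincide and contribute \<open>(2 p - 1)\<^sup>2\<close> otherwise. Around the circle the
  differences enclosed by a non-crossing pair cancel, so its entries coincide, whereas for a crossing
  pair coincidence is a nontrivial affine condition on the parameters. All exceptional tuples lie on
  boundedly many hyperplanes and are negligible.
\<close>

section \<open>Counting lattice points\<close>

text \<open>Convergence is therefore drawn from the self-similarity of the lattice count under
  refinement, and no volume is computed. The tuple set of a pairing refers to equality of random
  variables, whereas counting needs a purely arithmetic set. Every sum is therefore compared with
  the larger set given by the pair equations, and signed and unsigned sums become two constants
  times one common count. In the palindromic case each pair equation allows three shifts by
  multiples of \<open>N - 1\<close>. The tuples split into finitely many linear systems indexed by
  the shifts \<open>q\<close>, and a system is solvable around the circle only if its shifts add up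
  to zero. The same shifts threaten the claim that the entries of a non-crossing pair coincide,
  since indices may then agree only modulo \<open>N - 1\<close>. This ambiguity is confined to
  tuples containing the index \<open>1\<close>. The exponent counts vertices, not pairs, because the
  two entries of a crossing pair carry two independent signs of mean
  \<open>2 * p - 1\<close>.\<close>

lemma convergent_if_scaling_stable:
  fixes u :: "nat \<Rightarrow> real"
  assumes K: "\<And>m N. m \<ge> 1 \<Longrightarrow> N \<ge> 1 \<Longrightarrow> \<bar>u (m * N) - u N\<bar> \<le> K / real N"
  shows "convergent u"
proof -
  have K0: "K \<ge> 0" using K[of 1 1] by simp
  \<comment> \<open>Both \<open>u m\<close> and \<open>u N\<close> are compared with the value at
    the common multiple \<open>m * N\<close>.\<close>
  have pair: "\<bar>u m - u N\<bar> \<le> K / real m + K / real N" if "m \<ge> 1" "N \<ge> 1" for m N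
    using K[OF that] K[OF that(2,1)] by (simp add: mult.commute)
  have "Cauchy u"
  proof (rule CauchyI)
    fix e :: real assume e: "0 < e"
    obtain B :: nat where B: "2 * K / e < real B" using reals_Archimedean2 by blast
    show "\<exists>B. \<forall>m\<ge>B. \<forall>n\<ge>B. norm (u m - u n) < e"
    proof (intro exI[of _ "Suc B"] allI impI)
      fix m n assume mn: "Suc B \<le> m" "Suc B \<le> n"
      have small: "K / real l < e / 2" if "Suc B \<le> l" for l
      proof -
        have "2 * K / e < real l" using B that by linarith
        then show ?thesis using e that by (simp add: field_simps)
      qed
      show "norm (u m - u n) < e"
        using pair[of m n] small[OF mn(1)] small[OF mn(2)] mn unfolding real_norm_def by linarith
    qed
  qed
  then show ?thesis by (simp add: Cauchy_convergent_iff)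
qed

text \<open>Erasing the coordinate \<open>j\<close> is injective on \<open>X\<close>, so
  \<open>X\<close> is no larger than a box with one factor fewer.\<close>

lemma card_PiE_determined:
  assumes "finite J" "j \<in> J" "finite A" "X \<subseteq> J \<rightarrow>\<^sub>E A"
    and det: "\<And>x y. \<lbrakk>x \<in> X; y \<in> X; \<And>l. l \<in> J - {j} \<Longrightarrow> x l = y l\<rbrakk> \<Longrightarrow> x j = y j"
  shows "card X \<le> card A ^ (card J - 1)"
proof -
  have "inj_on (\<lambda>x. restrict x (J - {j})) X"
  proof (rule inj_onI)
    fix x y assume xy: "x \<in> X" "y \<in> X" "restrict x (J - {j}) = restrict y (J - {j})"
    have off: "x l = y l" if "l \<in> J - {j}" for l
      using fun_cong[OF xy(3), of l] that by simp
    have "x j = y j" using det[OF xy(1,2) off] by blast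
    then show "x = y"
      using off xy(1,2) assms(4) by (intro PiE_ext[of x J "\<lambda>_. A" y]) auto
  qed
  moreover have "(\<lambda>x. restrict x (J - {j})) ` X \<subseteq> (J - {j}) \<rightarrow>\<^sub>E A"
  proof (rule image_subsetI)
    fix x assume "x \<in> X"
    then have "x \<in> J \<rightarrow>\<^sub>E A" using assms(4) by blast
    then show "restrict x (J - {j}) \<in> (J - {j}) \<rightarrow>\<^sub>E A"
      by (intro restrict_PiE_iff[THEN iffD2]) auto
  qed
  moreover have "finite ((J - {j}) \<rightarrow>\<^sub>E A)" using assms by (intro finite_PiE) auto
  ultimately have "card X \<le> card ((J - {j}) \<rightarrow>\<^sub>E A)" by (rule card_inj_on_le)
  also have "\<dots> = card A ^ (card J - 1)" using assms(1,2) by (simp add: card_PiE)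
  finally show ?thesis .
qed

lemma card_affine_hyperplane:
  fixes a :: "'j \<Rightarrow> int"
  assumes "finite J" "j \<in> J" "a j \<noteq> 0"
  shows "card {x \<in> J \<rightarrow>\<^sub>E {- int N..<int N}. (\<Sum>j\<in>J. a j * x j) = t} \<le> (2 * N) ^ (card J - 1)"
proof -
  have "card {x \<in> J \<rightarrow>\<^sub>E {- int N..<int N}. (\<Sum>j\<in>J. a j * x j) = t}
      \<le> card {- int N..<int N} ^ (card J - 1)"
  proof (rule card_PiE_determined[OF assms(1,2)])
    fix x y
    assume x: "x \<in> {x \<in> J \<rightarrow>\<^sub>E {- int N..<int N}. (\<Sum>j\<in>J. a j * x j) = t}"
      and y: "y \<in> {x \<in> J \<rightarrow>\<^sub>E {- int N..<int N}. (\<Sum>j\<in>J. a j * x j) = t}"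
      and off: "\<And>l. l \<in> J - {j} \<Longrightarrow> x l = y l"
    have "(\<Sum>l\<in>J - {j}. a l * x l) = (\<Sum>l\<in>J - {j}. a l * y l)" using off by simp
    then have "a j * x j = a j * y j"
      using x y sum.remove[OF assms(1,2), of "\<lambda>l. a l * x l"]
        sum.remove[OF assms(1,2), of "\<lambda>l. a l * y l"] unfolding mem_Collect_eq by linarith
    then show "x j = y j" using assms(3) by simp
  qed auto
  also have "card {- int N..<int N} = 2 * N" by simp
  finally show ?thesis .
qed

text \<open>The half-open box makes scaling exact: the box at scale \<open>m * N\<close> is tiled by
  the points \<open>m * y + z\<close> with \<open>y\<close> in the box at scale \<open>N\<close> and
  residues \<open>z\<close> in [0, m). The terms \<open>e\<close> and \<open>f\<close> accommodate
  multiples of \<open>N - 1\<close>, whose part proportional to \<open>N\<close> scales exactly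
  while the constant part is a bounded perturbation.\<close>

definition affine_points ::
    "'j set \<Rightarrow> 'r set \<Rightarrow> ('r \<Rightarrow> 'j \<Rightarrow> int) \<Rightarrow> ('r \<Rightarrow> int) \<Rightarrow> ('r \<Rightarrow> int) \<Rightarrow> nat \<Rightarrow> ('j \<Rightarrow> int) set"
  where
  "affine_points J R a e f N =
     {x \<in> J \<rightarrow>\<^sub>E {- int N..<int N}.
        \<forall>r\<in>R. (\<Sum>j\<in>J. a r j * x j) + e r * int N + f r \<in> {0..<int N}}"

text \<open>
  Writing a point at scale \<open>m N\<close> as \<open>m y + z\<close> with \<open>0 \<le> z < m\<close> changes each form, relative to
  \<open>m\<close>, by a bounded amount only. Hence the count at scale \<open>m N\<close> is \<open>m ^ n\<close> times the count at
  scale \<open>N\<close>, up to the points \<open>y\<close> for which some form is close to \<open>0\<close> or \<open>N\<close>, and these lie on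
  boundedly many hyperplanes.
\<close>

lemma convergent_card_affine_points:
  fixes a :: "'r \<Rightarrow> 'j \<Rightarrow> int" and e f :: "'r \<Rightarrow> int"
  assumes fin: "finite J" "finite R" and "J \<noteq> {}"
    and nz: "\<And>r. r \<in> R \<Longrightarrow> \<exists>j\<in>J. a r j \<noteq> 0"
  shows "convergent (\<lambda>N. real (card (affine_points J R a e f N)) / real N ^ card J)"
proof -
  define n where "n = card J"
  have n: "n \<ge> 1" using assms by (simp add: n_def Suc_le_eq card_gt_0_iff)
  define C where "C = affine_points J R a e f"
  define box where "box N = J \<rightarrow>\<^sub>E {- int N..<int N}" for N
  define L where "L r x N = (\<Sum>j\<in>J. a r j * x j) + e r * int N + f r" for r x and N :: nat
  \<comment> \<open>\<open>K\<close> bounds, uniformly over the forms, the error per unit of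
    \<open>m\<close> made when a form at \<open>m * y + z\<close> is replaced by \<open>m\<close>
    times the form at \<open>y\<close>. Accordingly \<open>Bd\<close> is the layer where some form
    is within \<open>K\<close> of \<open>0\<close> or \<open>N\<close>.\<close>
  define K where "K = (\<Sum>r\<in>R. (\<Sum>j\<in>J. \<bar>a r j\<bar>) + \<bar>f r\<bar>)"
  define Bd where "Bd N = {y \<in> box N. \<exists>r\<in>R. \<exists>t\<in>{-K..K}. L r y N = t \<or> L r y N = int N + t}" for N
  have C_def': "C N = {x \<in> box N. \<forall>r\<in>R. L r x N \<in> {0..<int N}}" for N
    by (simp add: C_def box_def L_def affine_points_def)
  have finbox: "finite (box N)" for N unfolding box_def using fin by (intro finite_PiE) auto
  have Kr: "(\<Sum>j\<in>J. \<bar>a r j\<bar>) + \<bar>f r\<bar> \<le> K" if "r \<in> R" for r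
    unfolding K_def by (rule member_le_sum[OF that]) (auto intro!: add_nonneg_nonneg sum_nonneg fin)
  have K0: "K \<ge> 0" unfolding K_def by (auto intro!: sum_nonneg add_nonneg_nonneg)
  have hyper: "card {y \<in> box N. L r y N = t} \<le> (2 * N) ^ (n - 1)" if "r \<in> R" for r t N
  proof -
    obtain j where j: "j \<in> J" "a r j \<noteq> 0" using nz \<open>r \<in> R\<close> by blast
    have "{y \<in> box N. L r y N = t}
        = {x \<in> J \<rightarrow>\<^sub>E {- int N..<int N}. (\<Sum>j\<in>J. a r j * x j) = t - e r * int N - f r}"
      by (auto simp: box_def L_def)
    then show ?thesis using card_affine_hyperplane[of J j "a r", OF fin(1) j] by (simp add: n_def)
  qed
  define H where "H = card R * (card {-K..K} * 2)"
  have Bd: "card (Bd N) \<le> H * (2 * N) ^ (n - 1)" for N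
  proof -
    have "Bd N \<subseteq> (\<Union>r\<in>R. \<Union>t\<in>{-K..K}. \<Union>s\<in>{0, int N}. {y \<in> box N. L r y N = s + t})"
      by (auto simp: Bd_def)
    then have "card (Bd N)
        \<le> card (\<Union>r\<in>R. \<Union>t\<in>{-K..K}. \<Union>s\<in>{0, int N}. {y \<in> box N. L r y N = s + t})"
      by (rule card_mono[rotated]) (intro finite_UN_I fin(2) finite_Collect_conjI, auto simp: finbox)
    also have "\<dots> \<le> (\<Sum>r\<in>R. card (\<Union>t\<in>{-K..K}. \<Union>s\<in>{0, int N}. {y \<in> box N. L r y N = s + t}))"
      by (rule card_UN_le[OF fin(2)])
    also have "\<dots> \<le> (\<Sum>r\<in>R. card {-K..K} * (2 * (2 * N) ^ (n - 1)))"
    proof (rule sum_mono)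
      fix r assume r: "r \<in> R"
      have two: "card (\<Union>s\<in>{0, int N}. {y \<in> box N. L r y N = s + t}) \<le> 2 * (2 * N) ^ (n - 1)" for t
      proof -
        have "card (\<Union>s\<in>{0, int N}. {y \<in> box N. L r y N = s + t})
            \<le> (\<Sum>s\<in>{0, int N}. card {y \<in> box N. L r y N = s + t})"
          by (rule card_UN_le) simp
        also have "\<dots> \<le> of_nat (card {0, int N}) * (2 * N) ^ (n - 1)"
          by (rule sum_bounded_above) (rule hyper[OF r])
        also have "\<dots> \<le> 2 * (2 * N) ^ (n - 1)"
          by (intro mult_right_mono) (auto simp: card_insert_if)
        finally show ?thesis .
      qed
      have "card (\<Union>t\<in>{-K..K}. \<Union>s\<in>{0, int N}. {y \<in> box N. L r y N = s + t})
          \<le> (\<Sum>t\<in>{-K..K}. card (\<Union>s\<in>{0, int N}. {y \<in> box N. L r y N = s + t}))"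
        by (rule card_UN_le) simp
      also have "\<dots> \<le> (\<Sum>t\<in>{-K..K}. 2 * (2 * N) ^ (n - 1))"
        by (rule sum_mono) (rule two)
      also have "\<dots> = card {-K..K} * (2 * (2 * N) ^ (n - 1))"
        by (simp only: sum_constant of_nat_id)
      finally show "card (\<Union>t\<in>{-K..K}. \<Union>s\<in>{0, int N}. {y \<in> box N. L r y N = s + t})
          \<le> card {-K..K} * (2 * (2 * N) ^ (n - 1))" .
    qed
    also have "\<dots> = H * (2 * N) ^ (n - 1)" by (simp only: sum_constant of_nat_id H_def mult.assoc)
    finally show ?thesis .
  qed
  have compare: "\<bar>real (card (C (m * N))) - real m ^ n * real (card (C N))\<bar>
      \<le> real m ^ n * real (card (Bd N))" if m: "m \<ge> 1" and N: "N \<ge> 1" for m N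
  proof -
    define Z where "Z = J \<rightarrow>\<^sub>E {0..<int m}"
    define g where "g = (\<lambda>(y, z). restrict (\<lambda>j. int m * y j + z j) J)"
    have finZ: "finite Z" unfolding Z_def using fin by (intro finite_PiE) auto
    have cardZ: "card Z = m ^ n" using fin by (simp add: Z_def card_PiE n_def)
    have inj: "inj_on g (box N \<times> Z)"
    proof (rule inj_onI, clarsimp)
      fix y z y' z'
      assume *: "y \<in> box N" "z \<in> Z" "y' \<in> box N" "z' \<in> Z" and eq: "g (y, z) = g (y', z')"
      have "y j = y' j \<and> z j = z' j" if j: "j \<in> J" for j
      proof -
        have e: "int m * y j + z j = int m * y' j + z' j"
          using fun_cong[OF eq, of j] j by (simp add: g_def)
        have "z j \<in> {0..<int m}" "z' j \<in> {0..<int m}" using * j by (auto simp: Z_def)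
        then have "(int m * y j + z j) div int m = y j" "(int m * y' j + z' j) div int m = y' j"
          using m by (simp_all add: div_pos_pos_trivial)
        then show ?thesis using e by simp
      qed
      then show "y = y' \<and> z = z'"
        using * unfolding box_def Z_def
        by (metis PiE_ext)
    qed
    have surj: "x \<in> g ` (box N \<times> Z)" if x: "x \<in> box (m * N)" for x
    proof
      define y where "y = restrict (\<lambda>j. x j div int m) J"
      define z where "z = restrict (\<lambda>j. x j mod int m) J"
      have "x j div int m \<in> {- int N..<int N}" if "j \<in> J" for j
      proof -
        have "x j \<in> {- int (m * N)..<int (m * N)}" using x that by (auto simp: box_def)
        then have "int m * (- int N) \<le> x j" "x j < int m * int N" by auto
        moreover have "(int m * (- int N)) div int m \<le> x j div int m"
          using calculation m by (intro zdiv_mono1) auto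
        moreover have "x j div int m < int N"
        proof -
          have "int m * (x j div int m) \<le> x j"
            using m mult_div_mod_eq[of "int m" "x j"] pos_mod_sign[of "int m" "x j"] by linarith
          then have "int m * (x j div int m) < int m * int N" using calculation by simp
          then show ?thesis using m by simp
        qed
        moreover have "(int m * (- int N)) div int m = - int N"
          using m by (intro nonzero_mult_div_cancel_left) simp
        ultimately show ?thesis unfolding atLeastLessThan_iff by linarith
      qed
      then show "(y, z) \<in> box N \<times> Z" using m by (auto simp: box_def Z_def y_def z_def)
      have "x = restrict x J" using x by (auto simp: box_def PiE_def extensional_restrict)
      then show "x = g (y, z)"
        by (auto simp: g_def y_def z_def cong: restrict_cong)
    qed
    have gbox: "g (y, z) \<in> box (m * N)" if yz: "y \<in> box N" "z \<in> Z" for y z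
    proof -
      have "int m * y j + z j \<in> {- int (m * N)..<int (m * N)}" if "j \<in> J" for j
      proof -
        have y: "- int N \<le> y j" "y j \<le> int N - 1" and z: "0 \<le> z j" "z j < int m"
          using yz that by (auto simp: box_def Z_def PiE_def Pi_def)
        have "int m * (- int N) \<le> int m * y j" "int m * y j \<le> int m * (int N - 1)"
          using y by (intro mult_left_mono; simp)+
        then show ?thesis using z by (simp add: algebra_simps)
      qed
      then show ?thesis by (auto simp: g_def box_def)
    qed
    \<comment> \<open>The residues contribute at most \<open>m\<close> times the sum of the |a|, the
      constant changes by \<open>f * (1 - m)\<close>, and the term in \<open>N\<close>
      cancels.\<close>
    have near: "\<bar>L r (g (y, z)) (m * N) - int m * L r y N\<bar> \<le> int m * K"
      if "r \<in> R" "z \<in> Z" for r y z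
    proof -
      have "L r (g (y, z)) (m * N) - int m * L r y N
          = (\<Sum>j\<in>J. a r j * z j) + f r * (1 - int m)"
        by (simp add: L_def g_def algebra_simps sum.distrib sum_distrib_left cong: sum.cong)
      moreover have "\<bar>(\<Sum>j\<in>J. a r j * z j)\<bar> \<le> (\<Sum>j\<in>J. \<bar>a r j\<bar>) * int m"
        unfolding sum_distrib_right
      proof (rule order_trans[OF sum_abs sum_mono])
        fix j assume "j \<in> J"
        then have "0 \<le> z j" "z j < int m" using that by (auto simp: Z_def)
        then show "\<bar>a r j * z j\<bar> \<le> \<bar>a r j\<bar> * int m"
          by (simp add: abs_mult mult_left_mono)
      qed
      moreover have "\<bar>f r * (1 - int m)\<bar> \<le> \<bar>f r\<bar> * int m"
        using m by (auto simp: abs_mult intro!: mult_left_mono)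
      moreover have "((\<Sum>j\<in>J. \<bar>a r j\<bar>) + \<bar>f r\<bar>) * int m \<le> K * int m"
        using Kr[OF \<open>r \<in> R\<close>] by (intro mult_right_mono) auto
      ultimately show ?thesis
        unfolding distrib_right mult.commute[of "int m" K] by linarith
    qed
    \<comment> \<open>Away from the layer a violated bound survives the error \<open>m * K\<close>,
      so a point counted at scale \<open>m * N\<close> comes from \<open>C N\<close> or from the
      layer. For the same reason a satisfied bound survives in \<open>lower\<close>.\<close>
    have upper: "C (m * N) \<subseteq> g ` ((C N \<union> Bd N) \<times> Z)"
    proof
      fix x assume x: "x \<in> C (m * N)"
      then obtain y z where yz: "y \<in> box N" "z \<in> Z" "x = g (y, z)"
        using surj[of x] by (auto simp: C_def')
      have "y \<in> C N \<union> Bd N"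
      proof (rule ccontr)
        assume "y \<notin> C N \<union> Bd N"
        then obtain r where r: "r \<in> R" "L r y N \<notin> {0..<int N}" and nb: "y \<notin> Bd N"
          using yz(1) by (auto simp: C_def')
        have nb1: "L r y N \<noteq> t \<and> L r y N \<noteq> int N + t" if "t \<in> {-K..K}" for t
          using nb yz(1) r(1) that by (auto simp: Bd_def)
        have "L r y N < - K \<or> L r y N \<ge> int N + K"
          using r(2) nb1[of "L r y N"] nb1[of "L r y N - int N"] K0 by (force)
        moreover have "L r x (m * N) \<in> {0..<int (m * N)}" using x r(1) by (auto simp: C_def')
        moreover have "int m * L r y N \<le> int m * (- K - 1)" if "L r y N < - K"
          using that by (intro mult_left_mono) auto
        moreover have "int m * (int N + K) \<le> int m * L r y N" if "L r y N \<ge> int N + K"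
          using that by (intro mult_left_mono) auto
        ultimately show False
          using near[OF r(1) yz(2), of y] m unfolding yz(3)
          by (auto simp: algebra_simps abs_le_iff)
      qed
      then show "x \<in> g ` ((C N \<union> Bd N) \<times> Z)" using yz by auto
    qed
    have lower: "g ` ((C N - Bd N) \<times> Z) \<subseteq> C (m * N)"
    proof (clarify)
      fix y z assume y: "y \<in> C N" "y \<notin> Bd N" and z: "z \<in> Z"
      have yb: "y \<in> box N" using y by (simp add: C_def')
      have "L r (g (y, z)) (m * N) \<in> {0..<int (m * N)}" if r: "r \<in> R" for r
      proof -
        have nb1: "L r y N \<noteq> t \<and> L r y N \<noteq> int N + t" if "t \<in> {-K..K}" for t
          using y yb r that by (auto simp: Bd_def)
        have "L r y N \<in> {0..<int N}" using y r by (auto simp: C_def')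
        then have "L r y N \<ge> K" "L r y N < int N - K"
          using nb1[of "L r y N"] nb1[of "L r y N - int N"] K0 by force+
        then have "int m * K \<le> int m * L r y N" "int m * L r y N \<le> int m * (int N - K - 1)"
          by (intro mult_left_mono; simp)+
        moreover have "int m * L r y N - int m * K \<le> L r (g (y, z)) (m * N)"
          "L r (g (y, z)) (m * N) \<le> int m * L r y N + int m * K"
          using near[OF r z, of y] by linarith+
        moreover have "int m * (int N - K - 1) = int (m * N) - int m * K - int m"
          by (simp add: algebra_simps)
        ultimately show ?thesis using m unfolding atLeastLessThan_iff by linarith
      qed
      then show "g (y, z) \<in> C (m * N)" using gbox[OF yb z] by (simp add: C_def')
    qed
    have finC: "finite (C N)" "finite (C (m * N))" "finite (Bd N)"
      using finbox by (auto simp: C_def' Bd_def)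
    have "card (C (m * N)) \<le> card (g ` ((C N \<union> Bd N) \<times> Z))"
      using upper finC finZ by (intro card_mono) auto
    also have "\<dots> \<le> card ((C N \<union> Bd N) \<times> Z)"
      using finC finZ by (intro card_image_le) auto
    also have "\<dots> \<le> (card (C N) + card (Bd N)) * m ^ n"
      by (auto simp: card_cartesian_product cardZ intro!: mult_right_mono card_Un_le)
    finally have up: "real (card (C (m * N))) \<le> (real (card (C N)) + real (card (Bd N))) * real m ^ n"
      by (simp flip: of_nat_add of_nat_mult of_nat_power)
    have "card ((C N - Bd N) \<times> Z) = card (g ` ((C N - Bd N) \<times> Z))"
      by (rule card_image[symmetric]) (rule inj_on_subset[OF inj], auto simp: C_def')
    also have "\<dots> \<le> card (C (m * N))" using lower finC by (intro card_mono) auto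
    finally have lo1: "card (C N - Bd N) * m ^ n \<le> card (C (m * N))"
      by (simp add: card_cartesian_product cardZ)
    have "card (C N) \<le> card (C N - Bd N) + card (Bd N)"
      using finC by (metis card_Un_le card_mono finite_Diff finite_UnI Un_Diff_cancel2 Un_upper1 order_trans)
    then have "card (C N) * m ^ n \<le> (card (C N - Bd N) + card (Bd N)) * m ^ n" by simp
    also have "\<dots> \<le> card (C (m * N)) + card (Bd N) * m ^ n"
      using lo1 by (simp add: algebra_simps)
    finally have "real (card (C N)) * real m ^ n \<le> real (card (C (m * N))) + real (card (Bd N)) * real m ^ n"
      by (simp flip: of_nat_add of_nat_mult of_nat_power)
    then show ?thesis using up by (simp add: abs_le_iff algebra_simps)
  qed
  \<comment> \<open>The layer has O(N^(n-1)) points, so after division by \<open>(m * N) ^ n\<close>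
    the error is O(1/N) uniformly in \<open>m\<close>.\<close>
  have "convergent (\<lambda>N. real (card (C N)) / real N ^ n)"
  proof (rule convergent_if_scaling_stable)
    fix m N :: nat assume m: "m \<ge> 1" and N: "N \<ge> 1"
    have pos: "real (m * N) ^ n > 0" using m N by simp
    have "real (card (C (m * N))) / real (m * N) ^ n - real (card (C N)) / real N ^ n
        = (real (card (C (m * N))) - real m ^ n * real (card (C N))) / real (m * N) ^ n"
      using m N by (simp add: power_mult_distrib field_simps)
    also have "\<bar>\<dots>\<bar> \<le> (real m ^ n * real (card (Bd N))) / real (m * N) ^ n"
      using compare[OF m N] pos by (simp add: divide_right_mono)
    also have "\<dots> = real (card (Bd N)) / real N ^ n"
      using m by (simp add: power_mult_distrib)
    also have "\<dots> \<le> real (H * (2 * N) ^ (n - 1)) / real N ^ n"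
      using Bd[of N] by (intro divide_right_mono) (simp_all only: of_nat_le_iff, simp)
    also have "\<dots> = real H * 2 ^ (n - 1) / real N"
      using N n by (cases n) (simp_all add: power_mult_distrib)
    finally show "\<bar>real (card (C (m * N))) / real (m * N) ^ n - real (card (C N)) / real N ^ n\<bar>
        \<le> (real H * 2 ^ (n - 1)) / real N" .
  qed
  then show ?thesis by (simp add: C_def n_def)
qed

section \<open>Parametrising tuples by a pairing\<close>

locale pairing =
  fixes k :: nat and c :: "nat set set"
  assumes is_pairing: "is_pairing k c"
begin

abbreviation V :: "nat set" where "V \<equiv> {1..2 * k}"

definition partner :: "nat \<Rightarrow> nat" where "partner j = (THE l. {j, l} \<in> c)"

text \<open>Cutting the circle between \<open>2 * k\<close> and \<open>1\<close> turns every pair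
  into an interval from its opener to its partner.\<close>

definition openers :: "nat set" where "openers = {j \<in> V. j < partner j}"

lemma pair_in_V: "{j, l} \<in> c \<Longrightarrow> j \<in> V \<and> l \<in> V \<and> j \<noteq> l"
  using is_pairing unfolding is_pairing_def partition_on_def
  by (metis Union_iff card_2_iff doubleton_eq_iff insert_absorb2 insertI1 insert_commute)

lemma pair_unique: "{j, l} \<in> c \<Longrightarrow> {j, m} \<in> c \<Longrightarrow> l = m"
  using is_pairing unfolding is_pairing_def partition_on_def disjoint_def
  by (metis disjoint_iff doubleton_eq_iff insertI1)

lemma pair_partner: "j \<in> V \<Longrightarrow> {j, partner j} \<in> c"
proof -
  assume "j \<in> V"
  then obtain P where P: "P \<in> c" "j \<in> P"
    using is_pairing unfolding is_pairing_def partition_on_def by (metis UnionE)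
  then have "card P = 2" using is_pairing by (simp add: is_pairing_def)
  then obtain l where "P = {j, l}" using P(2) by (auto simp: card_2_iff)
  then show ?thesis unfolding partner_def using P(1)
    by (metis (mono_tags, lifting) pair_unique theI)
qed

lemma pair_iff: "{j, l} \<in> c \<longleftrightarrow> j \<in> V \<and> l = partner j"
  using pair_in_V pair_partner pair_unique by blast

lemma partner:
  assumes "j \<in> V"
  shows partner_in_V: "partner j \<in> V" and partner_partner: "partner (partner j) = j"
    and partner_neq: "partner j \<noteq> j"
proof -
  have "{partner j, j} \<in> c" "{j, partner j} \<in> c"
    using pair_partner[OF assms] by (auto simp: insert_commute)
  then show "partner j \<in> V" "partner (partner j) = j" "partner j \<noteq> j"
    using pair_iff pair_in_V by metis+
qed

lemma opener_in_V: "j \<in> openers \<Longrightarrow> j \<in> V" and opener_less: "j \<in> openers \<Longrightarrow> j < partner j"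
  by (auto simp: openers_def)

lemma finite_openers [simp]: "finite openers" by (simp add: openers_def)

lemma zero_not_opener [simp]: "0 \<notin> openers" by (simp add: openers_def)

lemma partner_opener_iff: "v \<in> V \<Longrightarrow> partner v \<in> openers \<longleftrightarrow> v \<notin> openers"
  using partner[of v] by (auto simp: openers_def not_less)

lemma V_eq: "V = openers \<union> partner ` openers" and
  openers_disjoint: "openers \<inter> partner ` openers = {}" and
  inj_partner: "inj_on partner V"
proof -
  show "V = openers \<union> partner ` openers"
  proof (intro subset_antisym subsetI)
    fix v assume v: "v \<in> V"
    show "v \<in> openers \<union> partner ` openers"
    proof (cases "v \<in> openers")
      case False
      then have "partner v \<in> openers" using partner_opener_iff[OF v] by blast
      then show ?thesis using partner_partner[OF v] by (metis UnI2 imageI)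
    qed simp
  qed (use partner_in_V opener_in_V in blast)
  show "openers \<inter> partner ` openers = {}"
    using partner_opener_iff opener_in_V by blast
  show "inj_on partner V" by (metis inj_onI partner_partner)
qed

lemma prod_V:
  fixes g :: "nat \<Rightarrow> 'b::comm_monoid_mult"
  shows "prod g V = (\<Prod>j\<in>openers. g j * g (partner j))"
proof -
  have "inj_on partner openers" using inj_partner opener_in_V by (auto intro: inj_on_subset)
  then show ?thesis
    by (subst V_eq, subst prod.union_disjoint)
       (auto simp: openers_disjoint prod.reindex prod.distrib)
qed

lemma card_openers: "card openers = k"
proof -
  have "inj_on partner openers" using inj_partner opener_in_V by (auto intro: inj_on_subset)
  then have "card V = card openers + card openers"
    by (subst V_eq, subst card_Un_disjoint) (auto simp: openers_disjoint card_image)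
  then show ?thesis by simp
qed

text \<open>After the cut, the rotations in \<open>clockwise\<close> and both namings of the
  endpoints collapse to one condition: some pair has exactly one vertex strictly inside the
  interval. In this shape crossing can be compared with the intervals summed in the linear forms
  below.\<close>

lemma crossing_pair_iff:
  assumes "j \<in> openers"
  shows "crossing_pair c {j, partner j} \<longleftrightarrow>
    (\<exists>u\<in>V. j < u \<and> u < partner j \<and> (partner u < j \<or> partner j < partner u))"
    (is "?L \<longleftrightarrow> ?R")
proof
  assume ?L
  then obtain a b x y where *: "{j, partner j} = {a, b}" "{x, y} \<in> c" "clockwise a x b y"
    unfolding crossing_pair_def by blast
  have xy: "x \<in> V" "y \<in> V" "partner x = y" "partner y = x"
    using *(2) pair_iff partner by metis+
  have "(a = j \<and> b = partner j) \<or> (a = partner j \<and> b = j)"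
    using *(1) by (auto simp: doubleton_eq_iff)
  then have "j < x \<and> x < partner j \<and> (y < j \<or> partner j < y) \<or>
      j < y \<and> y < partner j \<and> (x < j \<or> partner j < x)"
    using *(3) opener_less[OF assms] unfolding clockwise_def by (elim disjE conjE) simp_all
  then show ?R using xy by metis
next
  assume ?R
  then obtain u where u: "u \<in> V" "j < u" "u < partner j" "partner u < j \<or> partner j < partner u"
    by blast
  have "clockwise j u (partner j) (partner u)" using u by (auto simp: clockwise_def)
  then show ?L
    using pair_partner[OF u(1)] pair_partner[OF opener_in_V[OF assms]]
    unfolding crossing_pair_def by blast
qed

lemma crossing_vertices_eq: "crossing_vertices c = {v \<in> V. crossing_pair c {v, partner v}}"
proof (intro set_eqI iffI)
  fix v assume "v \<in> crossing_vertices c"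
  then obtain P where P: "crossing_pair c P" "v \<in> P" by (auto simp: crossing_vertices_def)
  then have "P \<in> c" "card P = 2"
    using is_pairing by (auto simp: crossing_pair_def is_pairing_def)
  then obtain l where "P = {v, l}" using P(2) by (auto simp: card_2_iff)
  then show "v \<in> {v \<in> V. crossing_pair c {v, partner v}}"
    using P(1) \<open>P \<in> c\<close> pair_iff[of v l] by simp
qed (auto simp: crossing_vertices_def)

lemma partner_crossing_iff:
  "v \<in> V \<Longrightarrow> partner v \<in> crossing_vertices c \<longleftrightarrow> v \<in> crossing_vertices c"
  using partner_in_V[of v] partner_partner[of v]
  by (simp add: crossing_vertices_eq insert_commute del: atLeastAtMost_iff)

text \<open>
  A tuple satisfying the pair equations is determined by its first index and the differences at
  the openers. These are its parameters, and \<open>form q N x v\<close> recovers the index at \<open>v\<close> (less one)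
  from them.
\<close>

definition solutions :: "(nat \<Rightarrow> int) \<Rightarrow> nat \<Rightarrow> (nat \<Rightarrow> nat) set" where
  "solutions q N = {i \<in> V \<rightarrow>\<^sub>E {1..N}.
     \<forall>j\<in>openers. index_diff k i j + index_diff k i (partner j) = q j * (int N - 1)}"

definition params :: "(nat \<Rightarrow> nat) \<Rightarrow> nat \<Rightarrow> int" where
  "params i = restrict (\<lambda>j. if j = 0 then int (i 1) - 1 else index_diff k i j) (insert 0 openers)"

text \<open>Telescoping: all differences at vertices before \<open>v\<close> are subtracted from the
  first index. A pair with both vertices before \<open>v\<close> contributes its total
  \<open>q j * (N - 1)\<close>, a pair with only its opener before \<open>v\<close> contributes
  \<open>x j\<close>, and later pairs contribute nothing.\<close>

definition form :: "(nat \<Rightarrow> int) \<Rightarrow> nat \<Rightarrow> (nat \<Rightarrow> int) \<Rightarrow> nat \<Rightarrow> int" where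
  "form q N x v = x 0 - (\<Sum>j\<in>openers. if j < v \<and> v \<le> partner j then x j else 0)
     - (int N - 1) * (\<Sum>j\<in>openers. if partner j < v then q j else 0)"

definition form_diff :: "(nat \<Rightarrow> int) \<Rightarrow> nat \<Rightarrow> (nat \<Rightarrow> int) \<Rightarrow> nat \<Rightarrow> int" where
  "form_diff q N x v =
     (if v \<in> openers then x v else q (partner v) * (int N - 1) - x (partner v))"

lemma form_1: "form q N x 1 = x 0"
proof -
  have "(\<Sum>j\<in>openers. if j < 1 \<and> 1 \<le> partner j then x j else 0) = 0"
    by (rule sum.neutral) (auto dest: opener_in_V)
  moreover have "(\<Sum>j\<in>openers. if partner j < 1 then q j else 0) = 0"
    by (rule sum.neutral) (use partner_in_V opener_in_V in fastforce)
  ultimately show ?thesis by (simp add: form_def)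
qed

text \<open>Beyond the last vertex every pair is closed and only the shifts remain. Since the circle
  returns to the first index, for \<open>N \<ge> 2\<close> there are solutions only if the shifts
  sum to zero.\<close>

lemma form_end: "form q N x (Suc (2 * k)) = x 0 - (int N - 1) * sum q openers"
proof -
  have P: "partner j < Suc (2 * k)" if "j \<in> openers" for j
    using partner_in_V[OF opener_in_V[OF that]] by simp
  have "(\<Sum>j\<in>openers. if j < Suc (2 * k) \<and> Suc (2 * k) \<le> partner j then x j else 0) = 0"
    by (rule sum.neutral) (use P in force)
  moreover have "(\<Sum>j\<in>openers. if partner j < Suc (2 * k) then q j else 0) = sum q openers"
    by (rule sum.cong) (use P in auto)
  ultimately show ?thesis by (simp add: form_def)
qed

text \<open>In the subtracted sum only the pair of \<open>v\<close> changes status: it either opens,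
  adding \<open>x v\<close>, or closes, its parameter being replaced by its total shift.\<close>

lemma form_Suc:
  assumes v: "v \<in> V"
  shows "form q N x v - form q N x (Suc v) = form_diff q N x v"
proof -
  have "form q N x v - form q N x (Suc v) =
     (\<Sum>j\<in>openers. (if j < Suc v \<and> Suc v \<le> partner j then x j else 0)
       - (if j < v \<and> v \<le> partner j then x j else 0)
       + (int N - 1) * ((if partner j < Suc v then q j else 0) - (if partner j < v then q j else 0)))"
    by (simp add: form_def sum.distrib sum_subtractf right_diff_distrib sum_distrib_left)
  also have "\<dots> = (\<Sum>j\<in>openers. (if j = v then x v else 0)
       + (if j = partner v then q (partner v) * (int N - 1) - x (partner v) else 0))"
  proof (rule sum.cong[OF refl])
    fix j assume j: "j \<in> openers"
    have less: "j < partner j" and jv: "j = partner v \<longleftrightarrow> partner j = v"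
      using opener_less[OF j] v partner_partner opener_in_V[OF j] by metis+
    show "(if j < Suc v \<and> Suc v \<le> partner j then x j else 0)
       - (if j < v \<and> v \<le> partner j then x j else 0)
       + (int N - 1) * ((if partner j < Suc v then q j else 0) - (if partner j < v then q j else 0))
      = (if j = v then x v else 0)
       + (if j = partner v then q (partner v) * (int N - 1) - x (partner v) else 0)"
    proof (cases "partner j = v")
      case True
      then have "j = partner v" "j < v" using jv less by auto
      then show ?thesis using True by (simp add: algebra_simps)
    next
      case False
      then have "j \<noteq> partner v" using jv by simp
      then show ?thesis using False less by (cases "j = v") (auto simp: less_Suc_eq)
    qed
  qed
  also have "\<dots> = form_diff q N x v"
    using partner_opener_iff[OF v]
    by (auto simp: sum.distrib sum.delta form_diff_def)
  finally show ?thesis .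
qed

section \<open>Tuples and their parameters determine each other\<close>

lemma index_diff_less: "v \<in> V \<Longrightarrow> v \<noteq> 2 * k \<Longrightarrow> index_diff k i v = int (i v) - int (i (Suc v))"
  by (simp add: index_diff_def next_vertex_def)

lemma index_diff_last: "index_diff k i (2 * k) = int (i (2 * k)) - int (i 1)"
  by (simp add: index_diff_def next_vertex_def)

lemma index_diff_solution:
  assumes "i \<in> solutions q N" "v \<in> V"
  shows "index_diff k i v = form_diff q N (params i) v"
proof (cases "v \<in> openers")
  case True
  then show ?thesis using assms by (auto simp: form_diff_def params_def)
next
  case False
  then have "partner v \<in> openers" using partner_opener_iff assms(2) by blast
  moreover have "partner v \<noteq> 0" using partner_in_V[OF assms(2)] by auto
  ultimately have "index_diff k i (partner v) + index_diff k i v = q (partner v) * (int N - 1)"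
    using assms partner_partner[OF assms(2)] unfolding solutions_def by fastforce
  then show ?thesis using False \<open>partner v \<in> openers\<close> \<open>partner v \<noteq> 0\<close>
    by (simp add: form_diff_def params_def)
qed

lemma form_params:
  assumes i: "i \<in> solutions q N" and "v \<in> V"
  shows "form q N (params i) v = int (i v) - 1"
  using \<open>v \<in> V\<close>
proof (induction v)
  case (Suc v)
  show ?case
  proof (cases "v = 0")
    case True
    have "params i 0 = int (i 1) - 1" by (simp add: params_def)
    then show ?thesis using form_1[of q N "params i"] True by simp
  next
    case False
    then have v: "v \<in> V" "v \<noteq> 2 * k" using Suc.prems by auto
    have "form q N (params i) v - form q N (params i) (Suc v) = int (i v) - int (i (Suc v))"
      using form_Suc[OF v(1)] index_diff_solution[OF i v(1)] index_diff_less[OF v] by simp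
    then show ?thesis using Suc.IH[OF v(1)] by simp
  qed
qed simp

lemma sum_q_zero:
  assumes "k \<ge> 1" "N \<ge> 2" and i: "i \<in> solutions q N"
  shows "sum q openers = 0"
proof -
  have v: "2 * k \<in> V" using assms by simp
  have "form q N (params i) (2 * k) - form q N (params i) (Suc (2 * k)) = int (i (2 * k)) - int (i 1)"
    using form_Suc[OF v] index_diff_solution[OF i v] index_diff_last by simp
  moreover have "form q N (params i) (Suc (2 * k)) = int (i 1) - 1 - (int N - 1) * sum q openers"
    using form_end by (simp add: params_def)
  ultimately show ?thesis using form_params[OF i v] assms(2) by simp
qed

lemma params_in_box:
  assumes "i \<in> solutions q N" "k \<ge> 1"
  shows "params i \<in> insert 0 openers \<rightarrow>\<^sub>E {- int N..<int N}"
proof -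
  have rng: "1 \<le> i v \<and> i v \<le> N" if "v \<in> V" for v using assms(1) that by (auto simp: solutions_def)
  have "index_diff k i j \<in> {- int N..<int N}" if "j \<in> openers" for j
  proof -
    have "next_vertex k j \<in> V" using opener_in_V[OF that] by (auto simp: next_vertex_def)
    then show ?thesis using rng[of "next_vertex k j"] rng[OF opener_in_V[OF that]]
      by (simp add: index_diff_def)
  qed
  moreover have "int (i 1) - 1 \<in> {- int N..<int N}" using rng[of 1] assms(2) by simp
  ultimately show ?thesis by (auto simp: params_def)
qed

lemma inj_params: "inj_on params (solutions q N)"
proof (rule inj_onI)
  fix i i' assume *: "i \<in> solutions q N" "i' \<in> solutions q N" "params i = params i'"
  have "i v = i' v" if "v \<in> V" for v
    using form_params[OF *(1) that] form_params[OF *(2) that] *(3) by simp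
  then show "i = i'" using *(1,2) unfolding solutions_def by (intro PiE_ext[of i V "\<lambda>_. {1..N}" i']) auto
qed

text \<open>The pair equations are built into the parametrisation, so only the range of the indices
  remains as a condition. The assumption on \<open>q\<close> enters at the last vertex, whose
  difference wraps around to the first index.\<close>

lemma params_image:
  assumes "k \<ge> 1" "sum q openers = 0"
  shows "params ` solutions q N =
    {x \<in> insert 0 openers \<rightarrow>\<^sub>E {- int N..<int N}. \<forall>v\<in>V. form q N x v \<in> {0..<int N}}"
proof (intro subset_antisym subsetI)
  fix x assume "x \<in> params ` solutions q N"
  then obtain i where i: "i \<in> solutions q N" "x = params i" by blast
  have "form q N x v \<in> {0..<int N}" if "v \<in> V" for v
  proof -
    have "i v \<in> {1..N}" using i(1) that unfolding solutions_def by blast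
    then show ?thesis using form_params[OF i(1) that] i(2) by auto
  qed
  then show "x \<in> {x \<in> insert 0 openers \<rightarrow>\<^sub>E {- int N..<int N}. \<forall>v\<in>V. form q N x v \<in> {0..<int N}}"
    using params_in_box[OF i(1) assms(1)] i(2) by blast
next
  fix x
  assume "x \<in> {x \<in> insert 0 openers \<rightarrow>\<^sub>E {- int N..<int N}. \<forall>v\<in>V. form q N x v \<in> {0..<int N}}"
  then have x: "x \<in> insert 0 openers \<rightarrow>\<^sub>E {- int N..<int N}"
    and f: "\<And>v. v \<in> V \<Longrightarrow> 0 \<le> form q N x v \<and> form q N x v < int N" by auto
  define i where "i = restrict (\<lambda>v. nat (form q N x v + 1)) V"
  have i: "int (i v) = form q N x v + 1" if "v \<in> V" for v using f[OF that] that by (simp add: i_def)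
  have dif: "index_diff k i v = form_diff q N x v" if v: "v \<in> V" for v
  proof (cases "v = 2 * k")
    case True
    have "1 \<in> V" using assms by simp
    have "form q N x 1 = form q N x (Suc (2 * k))" using assms form_1 form_end by simp
    then show ?thesis
      using form_Suc[OF v, of q N x] i[OF v] i[OF \<open>1 \<in> V\<close>] True by (simp add: index_diff_last)
  next
    case False
    then have "Suc v \<in> V" using v by simp
    then show ?thesis
      using form_Suc[OF v, of q N x] i[OF v] i[OF \<open>Suc v \<in> V\<close>] index_diff_less[OF v False] by simp
  qed
  have "i \<in> solutions q N"
    unfolding solutions_def
  proof (intro CollectI conjI ballI)
    show "i \<in> V \<rightarrow>\<^sub>E {1..N}"
    proof (rule PiE_I)
      fix v assume "v \<in> V"
      then show "i v \<in> {1..N}" using i f by fastforce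
    qed (simp add: i_def del: atLeastAtMost_iff)
    fix j assume j: "j \<in> openers"
    then have "j \<in> V" "partner j \<in> V" "partner j \<notin> openers"
      using opener_in_V partner_in_V partner_opener_iff by blast+
    then show "index_diff k i j + index_diff k i (partner j) = q j * (int N - 1)"
      using j partner_partner[OF \<open>j \<in> V\<close>] by (simp add: dif form_diff_def del: atLeastAtMost_iff)
  qed
  moreover have "params i = x"
  proof (rule PiE_ext)
    show "params i \<in> insert 0 openers \<rightarrow>\<^sub>E {- int N..<int N}"
      using params_in_box[OF calculation assms(1)] .
    fix j assume "j \<in> insert 0 openers"
    then show "params i j = x j"
      using dif[OF opener_in_V, of j] i[of 1] form_1[of q N x] assms(1)
      by (auto simp: params_def form_diff_def)
  qed (rule x)
  ultimately show "x \<in> params ` solutions q N" by blast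
qed

lemma convergent_card_solutions:
  assumes "k \<ge> 1"
  shows "convergent (\<lambda>N. real (card (solutions q N)) / real N ^ (k + 1))"
proof (cases "sum q openers = 0")
  case False
  have "\<forall>\<^sub>F N in sequentially. real (card (solutions q N)) / real N ^ (k + 1) = 0"
  proof (rule eventually_sequentiallyI[of 2])
    fix N :: nat assume "2 \<le> N"
    then have "solutions q N = {}" using sum_q_zero[OF assms \<open>2 \<le> N\<close>] False by blast
    then show "real (card (solutions q N)) / real N ^ (k + 1) = 0" by simp
  qed
  then show ?thesis by (intro convergentI tendsto_eventually)
next
  case True
  \<comment> \<open>The coefficient \<open>1\<close> at parameter \<open>0\<close> keeps every form
    nonconstant, as the counting lemma demands. In \<open>lin\<close> the shift
    \<open>- (N - 1) * g v\<close> is split into \<open>- g v * N\<close> and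
    \<open>g v\<close>.\<close>
  define a :: "nat \<Rightarrow> nat \<Rightarrow> int" where
    "a = (\<lambda>v j. if j = 0 then 1 else if j < v \<and> v \<le> partner j then -1 else 0)"
  define g where "g v = (\<Sum>j\<in>openers. if partner j < v then q j else 0)" for v
  have lin: "form q N x v = (\<Sum>j\<in>insert 0 openers. a v j * x j) + (- g v) * int N + g v" for N x v
  proof -
    have "(\<Sum>j\<in>openers. a v j * x j) = - (\<Sum>j\<in>openers. if j < v \<and> v \<le> partner j then x j else 0)"
      unfolding sum_negf[symmetric] by (rule sum.cong[OF refl]) (auto simp: a_def)
    then show ?thesis
      by (simp add: form_def g_def[symmetric] algebra_simps) (simp add: a_def)
  qed
  have "card (solutions q N) = card (affine_points (insert 0 openers) V a (\<lambda>v. - g v) g N)" for N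
    using params_image[OF assms True] card_image[OF inj_params, of q N]
    by (simp add: affine_points_def lin del: atLeastAtMost_iff)
  moreover have "convergent (\<lambda>N. real (card (affine_points (insert 0 openers) V a (\<lambda>v. - g v) g N))
      / real N ^ card (insert 0 openers))"
    by (rule convergent_card_affine_points) (auto simp: a_def)
  ultimately show ?thesis by (simp add: card_openers)
qed

end

section \<open>Negligible sets of tuples\<close>

fun shifts :: "ensemble \<Rightarrow> int set" where
  "shifts Toeplitz = {0}"
| "shifts Palindromic = {-1, 0, 1}"

lemma finite_shifts [simp]: "finite (shifts E)"
  by (cases E) simp_all

lemma opposite_diffs_iff:
  "opposite_diffs E N d d' \<longleftrightarrow> (\<exists>q\<in>shifts E. d + d' = q * (int N - 1))"
  by (cases E) auto

context pairing
begin

text \<open>The arithmetic part of \<open>pairing_tuples\<close>: the requirement on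
  \<open>same_rv\<close> is dropped, so this set does not depend on \<open>M\<close> or
  \<open>b\<close>.\<close>

definition pair_tuples :: "ensemble \<Rightarrow> nat \<Rightarrow> (nat \<Rightarrow> nat) set" where
  "pair_tuples E N = {i \<in> V \<rightarrow>\<^sub>E {1..N}.
     \<forall>j\<in>openers. opposite_diffs E N (index_diff k i j) (index_diff k i (partner j))}"

lemma solutions_subset: "solutions q N \<subseteq> V \<rightarrow>\<^sub>E {1..N}"
  by (auto simp: solutions_def)

lemma finite_solutions [simp]: "finite (solutions q N)"
  by (rule finite_subset[OF solutions_subset]) (simp add: finite_PiE)

lemma pair_tuples_eq: "pair_tuples E N = (\<Union>q\<in>openers \<rightarrow>\<^sub>E shifts E. solutions q N)"
proof (intro subset_antisym subsetI)
  fix i assume i: "i \<in> pair_tuples E N"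
  then have "\<forall>j\<in>openers. \<exists>q. q \<in> shifts E \<and>
      index_diff k i j + index_diff k i (partner j) = q * (int N - 1)"
    by (auto simp: pair_tuples_def opposite_diffs_iff)
  then obtain q where q: "\<forall>j\<in>openers. q j \<in> shifts E \<and>
      index_diff k i j + index_diff k i (partner j) = q j * (int N - 1)" by metis
  then have "restrict q openers \<in> openers \<rightarrow>\<^sub>E shifts E" "i \<in> solutions (restrict q openers) N"
    using i by (auto simp: solutions_def pair_tuples_def)
  then show "i \<in> (\<Union>q\<in>openers \<rightarrow>\<^sub>E shifts E. solutions q N)" by blast
qed (fastforce simp: solutions_def pair_tuples_def opposite_diffs_iff)

lemma finite_pair_tuples [simp]: "finite (pair_tuples E N)"
  by (simp add: pair_tuples_eq finite_PiE)

text \<open>For \<open>N \<ge> 2\<close> the factor \<open>N - 1\<close> is nonzero, so a tuple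
  determines its shifts and the union over \<open>q\<close> is disjoint.\<close>

lemma card_pair_tuples:
  assumes "N \<ge> 2"
  shows "card (pair_tuples E N) = (\<Sum>q\<in>openers \<rightarrow>\<^sub>E shifts E. card (solutions q N))"
  unfolding pair_tuples_eq
proof (rule card_UN_disjoint)
  show "\<forall>q\<in>openers \<rightarrow>\<^sub>E shifts E. \<forall>q'\<in>openers \<rightarrow>\<^sub>E shifts E.
      q \<noteq> q' \<longrightarrow> solutions q N \<inter> solutions q' N = {}"
  proof (intro ballI impI equals0I)
    fix q q' i
    assume q: "q \<in> openers \<rightarrow>\<^sub>E shifts E" "q' \<in> openers \<rightarrow>\<^sub>E shifts E" "q \<noteq> q'"
      and i: "i \<in> solutions q N \<inter> solutions q' N"
    have "q j = q' j" if "j \<in> openers" for j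
    proof -
      have "q j * (int N - 1) = q' j * (int N - 1)" using i that by (auto simp: solutions_def)
      then show ?thesis using assms by simp
    qed
    then show False using q PiE_ext by metis
  qed
qed (auto intro: finite_PiE)

lemma convergent_card_pair_tuples:
  assumes "k \<ge> 1"
  shows "convergent (\<lambda>N. real (card (pair_tuples E N)) / real N ^ (k + 1))"
proof -
  have "convergent (\<lambda>N. \<Sum>q\<in>openers \<rightarrow>\<^sub>E shifts E. real (card (solutions q N)) / real N ^ (k + 1))"
    by (intro convergent_sum convergent_card_solutions assms)
  moreover have "\<forall>\<^sub>F N in sequentially.
      (\<Sum>q\<in>openers \<rightarrow>\<^sub>E shifts E. real (card (solutions q N)) / real N ^ (k + 1))
      = real (card (pair_tuples E N)) / real N ^ (k + 1)"
    by (rule eventually_sequentiallyI[of 2]) (simp add: card_pair_tuples sum_divide_distrib)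
  ultimately show ?thesis by (subst (asm) convergent_cong)
qed

text \<open>One order below the normalisation \<open>N ^ (k + 1)\<close>.\<close>

definition negligible :: "(nat \<Rightarrow> (nat \<Rightarrow> nat) set) \<Rightarrow> bool" where
  "negligible B \<longleftrightarrow> (\<exists>K. \<forall>N. finite (B N) \<and> card (B N) \<le> K * N ^ k)"

lemma negligible_UN:
  assumes "finite I" "\<And>s. s \<in> I \<Longrightarrow> negligible (B s)"
  shows "negligible (\<lambda>N. \<Union>s\<in>I. B s N)"
proof -
  have "\<forall>s\<in>I. \<exists>K. \<forall>N. finite (B s N) \<and> card (B s N) \<le> K * N ^ k"
    using assms(2) by (simp add: negligible_def)
  then obtain K where K: "\<forall>s\<in>I. \<forall>N. finite (B s N) \<and> card (B s N) \<le> K s * N ^ k" by metis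
  have "card (\<Union>s\<in>I. B s N) \<le> (\<Sum>s\<in>I. K s) * N ^ k" for N
  proof -
    have "card (\<Union>s\<in>I. B s N) \<le> (\<Sum>s\<in>I. card (B s N))" by (rule card_UN_le[OF assms(1)])
    also have "\<dots> \<le> (\<Sum>s\<in>I. K s * N ^ k)" using K by (intro sum_mono) blast
    finally show ?thesis by (simp add: sum_distrib_right)
  qed
  then show ?thesis unfolding negligible_def using K assms(1) by (intro exI[of _ "\<Sum>s\<in>I. K s"]) auto
qed

lemma negligible_Bex:
  assumes "finite I" "\<And>s. s \<in> I \<Longrightarrow> negligible (\<lambda>N. {i \<in> S N. P s N i})"
  shows "negligible (\<lambda>N. {i \<in> S N. \<exists>s\<in>I. P s N i})"
proof -
  have "{i \<in> S N. \<exists>s\<in>I. P s N i} = (\<Union>s\<in>I. {i \<in> S N. P s N i})" for N by blast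
  then show ?thesis using negligible_UN[OF assms] by presburger
qed

lemma negligible_disj:
  assumes "negligible (\<lambda>N. {i \<in> S N. P N i})" "negligible (\<lambda>N. {i \<in> S N. Q N i})"
  shows "negligible (\<lambda>N. {i \<in> S N. P N i \<or> Q N i})"
proof -
  have "{i \<in> S N. P N i \<or> Q N i} = (\<Union>s\<in>UNIV. {i \<in> S N. if s then P N i else Q N i})" for N
    by (auto simp: UNIV_bool)
  moreover have "negligible (\<lambda>N. {i \<in> S N. if s then P N i else Q N i})" for s
    using assms by (cases s) simp_all
  ultimately show ?thesis
    using negligible_UN[of "UNIV :: bool set" "\<lambda>s N. {i \<in> S N. if s then P N i else Q N i}"]
    by simp
qed

lemma negligible_card_tendsto:
  assumes "negligible B"
  shows "(\<lambda>N. real (card (B N)) / real N ^ (k + 1)) \<longlonglongrightarrow> 0"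
proof -
  obtain K where K: "\<And>N. card (B N) \<le> K * N ^ k" using assms by (auto simp: negligible_def)
  have lim: "(\<lambda>N. real K * (1 / real N)) \<longlonglongrightarrow> real K * 0"
    by (intro tendsto_mult tendsto_const lim_1_over_n)
  have bound: "\<forall>\<^sub>F N in sequentially. norm (real (card (B N)) / real N ^ (k + 1)) \<le> real K * (1 / real N)"
  proof (rule eventually_sequentiallyI[of 1])
    fix N :: nat assume "1 \<le> N"
    have "real (card (B N)) \<le> real K * real N ^ k"
      using K[of N] by (simp flip: of_nat_mult of_nat_power)
    then show "norm (real (card (B N)) / real N ^ (k + 1)) \<le> real K * (1 / real N)"
      using \<open>1 \<le> N\<close> by (simp add: divide_simps)
  qed
  show ?thesis by (rule Lim_null_comparison[OF bound]) (use lim in simp)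
qed

text \<open>Of the \<open>k + 1\<close> parameters only \<open>k\<close> remain free, each with
  \<open>2 * N\<close> values. The determined one may depend on \<open>N\<close> and on the others
  in any way, so each linear condition below only has to be solved for one parameter.\<close>

lemma negligible_determined:
  assumes "k \<ge> 1" and j: "j \<in> insert 0 openers"
    and det: "\<And>N i i'. \<lbrakk>i \<in> solutions q N; i' \<in> solutions q N; P N i; P N i';
      \<And>l. l \<in> insert 0 openers - {j} \<Longrightarrow> params i l = params i' l\<rbrakk> \<Longrightarrow> params i j = params i' j"
  shows "negligible (\<lambda>N. {i \<in> solutions q N. P N i})"
proof -
  have "card {i \<in> solutions q N. P N i} \<le> 2 ^ k * N ^ k" for N
  proof -
    have "card {i \<in> solutions q N. P N i} = card (params ` {i \<in> solutions q N. P N i})"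
      by (rule card_image[symmetric]) (rule inj_on_subset[OF inj_params], auto)
    also have "\<dots> \<le> card {- int N..<int N} ^ (card (insert 0 openers) - 1)"
    proof (rule card_PiE_determined[OF _ j])
      show "params ` {i \<in> solutions q N. P N i} \<subseteq> insert 0 openers \<rightarrow>\<^sub>E {- int N..<int N}"
        using params_in_box[OF _ assms(1)] by blast
    next
      fix x y
      assume "x \<in> params ` {i \<in> solutions q N. P N i}" "y \<in> params ` {i \<in> solutions q N. P N i}"
        and off: "\<And>l. l \<in> insert 0 openers - {j} \<Longrightarrow> x l = y l"
      then obtain i i' where ii: "i \<in> solutions q N" "P N i" "x = params i"
         "i' \<in> solutions q N" "P N i'" "y = params i'"
        by blast
      show "x j = y j"
        using det[OF ii(1,4,2,5)] off unfolding ii(3,6) by blast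
    qed auto
    also have "\<dots> = (2 * N) ^ k" by (simp add: card_openers nat_mult_distrib)
    also have "\<dots> = 2 ^ k * N ^ k" by (rule power_mult_distrib)
    finally show ?thesis .
  qed
  then show ?thesis unfolding negligible_def by (intro exI[of _ "2 ^ k"]) auto
qed

text \<open>Every form contains parameter \<open>0\<close> with coefficient \<open>1\<close>, so a
  prescribed index fixes this parameter once the differences are known.\<close>

lemma negligible_index_eq:
  assumes "k \<ge> 1" "v \<in> V"
  shows "negligible (\<lambda>N. {i \<in> solutions q N. i v = t})"
proof (rule negligible_determined[where j = 0, OF assms(1)])
  fix N i i'
  assume i: "i \<in> solutions q N" "i' \<in> solutions q N" "i v = t" "i' v = t"
    and off: "\<And>l. l \<in> insert 0 openers - {0} \<Longrightarrow> params i l = params i' l"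
  have "(\<Sum>j\<in>openers. if j < v \<and> v \<le> partner j then params i j else 0)
      = (\<Sum>j\<in>openers. if j < v \<and> v \<le> partner j then params i' j else 0)"
  proof (rule sum.cong[OF refl])
    fix j assume "j \<in> openers"
    then have "j \<in> insert 0 openers - {0}" by (metis DiffI insertI2 singletonD zero_not_opener)
    then show "(if j < v \<and> v \<le> partner j then params i j else 0)
        = (if j < v \<and> v \<le> partner j then params i' j else 0)" using off by simp
  qed
  then show "params i 0 = params i' 0"
    using form_params[OF i(1) assms(2)] form_params[OF i(2) assms(2)] i(3,4) by (simp add: form_def)
qed simp

text \<open>Up to sign and shift, the difference at \<open>j\<close> is the parameter of its own
  pair, while the difference at \<open>l\<close> involves only the parameter of another
  pair.\<close>

lemma negligible_diff_relation:
  assumes "k \<ge> 1" and j: "j \<in> V" and l: "l \<in> V" "l \<noteq> j" "l \<noteq> partner j"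
  shows "negligible (\<lambda>N. {i \<in> solutions q N. index_diff k i j + s * index_diff k i l = t N})"
proof -
  define f where "f = (if j \<in> openers then j else partner j)"
  have f: "f \<in> openers" using partner_opener_iff[OF j] by (simp add: f_def)
  show ?thesis
  proof (rule negligible_determined[where j = f, OF assms(1)])
    fix N i i'
    assume i: "i \<in> solutions q N" "i' \<in> solutions q N"
      and e: "index_diff k i j + s * index_diff k i l = t N"
        "index_diff k i' j + s * index_diff k i' l = t N"
      and off: "\<And>l. l \<in> insert 0 openers - {f} \<Longrightarrow> params i l = params i' l"
    have lf: "l \<noteq> f" "partner l \<noteq> f"
      using l j partner_partner[OF l(1)] partner_partner[OF j] by (auto simp: f_def)
    have "index_diff k i l = index_diff k i' l"
      using lf off partner_opener_iff[OF l(1)] unfolding index_diff_solution[OF i(1) l(1)]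
        index_diff_solution[OF i(2) l(1)] form_diff_def by auto
    then have "index_diff k i j = index_diff k i' j" using e by simp
    then have "form_diff q N (params i) j = form_diff q N (params i') j"
      by (simp only: index_diff_solution[OF i(1) j] index_diff_solution[OF i(2) j])
    then show "params i f = params i' f"
      by (simp add: form_diff_def f_def split: if_splits)
  qed (use f in simp)
qed

text \<open>With the pair equation, equality gives
  \<open>2 * index_diff k i j = q j * (int N - 1)\<close>, which leaves at most one value for the
  difference.\<close>

lemma negligible_diff_eq:
  assumes "k \<ge> 1" and j: "j \<in> openers"
  shows "negligible (\<lambda>N. {i \<in> solutions q N. index_diff k i j = index_diff k i (partner j)})"
proof (rule negligible_determined[where j = j, OF assms(1)])
  fix N i i'
  assume i: "i \<in> solutions q N" "i' \<in> solutions q N"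
    and e: "index_diff k i j = index_diff k i (partner j)"
      "index_diff k i' j = index_diff k i' (partner j)"
  have "2 * index_diff k i j = q j * (int N - 1)" "2 * index_diff k i' j = q j * (int N - 1)"
    using i e j by (auto simp: solutions_def)
  then have "index_diff k i j = index_diff k i' j" by linarith
  moreover have "j \<noteq> 0" using j by (metis zero_not_opener)
  ultimately show "params i j = params i' j" using j by (simp add: params_def)
qed (use j in simp)

text \<open>If \<open>u\<close> lies inside the pair and its partner outside, the interval of that
  second pair separates \<open>Suc j\<close> from \<open>partner j\<close>. Its parameter enters
  exactly one of the two forms, so their equality determines it.\<close>

lemma negligible_crossing_coincidence:
  assumes "k \<ge> 1" and j: "j \<in> openers" and cr: "crossing_pair c {j, partner j}"
  shows "negligible (\<lambda>N. {i \<in> solutions q N. i (Suc j) = i (partner j)})"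
proof -
  obtain u where u: "u \<in> V" "j < u" "u < partner j" "partner u < j \<or> partner j < partner u"
    using cr crossing_pair_iff[OF j] by blast
  define f where "f = (if u \<in> openers then u else partner u)"
  have f: "f \<in> openers" using partner_opener_iff[OF u(1)] by (simp add: f_def)
  have V': "Suc j \<in> V" "partner j \<in> V"
    using opener_in_V[OF j] partner_in_V[OF opener_in_V[OF j]] u by auto
  have f_cases: "f < Suc j \<and> Suc j \<le> partner f \<longleftrightarrow> \<not> (f < partner j \<and> partner j \<le> partner f)"
    using u partner_partner[OF u(1)] opener_less[OF f] by (auto simp: f_def split: if_splits)
  show ?thesis
  proof (rule negligible_determined[where j = f, OF assms(1)])
    fix N i i'
    assume i: "i \<in> solutions q N" "i' \<in> solutions q N"
      and e: "i (Suc j) = i (partner j)" "i' (Suc j) = i' (partner j)"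
      and off: "\<And>l. l \<in> insert 0 openers - {f} \<Longrightarrow> params i l = params i' l"
    let ?r = "\<lambda>v. if f < v \<and> v \<le> partner f then params i f - params i' f else 0"
    have change: "form q N (params i) v - form q N (params i') v = - ?r v" for v
    proof -
      have "f \<noteq> 0" using f zero_not_opener by metis
      then have "0 \<in> insert 0 openers - {f}" by simp
      then have "params i 0 = params i' 0" by (rule off)
      moreover have "(\<Sum>j\<in>openers. if j < v \<and> v \<le> partner j then params i j else 0)
          - (\<Sum>j\<in>openers. if j < v \<and> v \<le> partner j then params i' j else 0)
          = (\<Sum>j\<in>openers. if j = f then ?r v else 0)"
        unfolding sum_subtractf[symmetric] using off by (intro sum.cong) auto
      ultimately show ?thesis using f by (simp add: form_def)
    qed
    have "?r (Suc j) = ?r (partner j)"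
      using change[of "Suc j"] change[of "partner j"] e form_params[OF i(1) V'(1)]
        form_params[OF i(1) V'(2)] form_params[OF i(2) V'(1)] form_params[OF i(2) V'(2)] by linarith
    then show "params i f = params i' f" using f_cases by (auto split: if_splits)
  qed (use f in simp)
qed

text \<open>Each clause removes an obstruction. An index \<open>1\<close> may differ from another
  index by the full \<open>N - 1\<close>. A relation with sign \<open>s\<close> and shift
  \<open>t\<close> may identify the random variables or the matrix positions of different pairs. The
  last two clauses cover the two ways in which the positions of a crossing pair may coincide, with
  equal or with reversed order of the indices.\<close>

definition degenerate :: "nat \<Rightarrow> (nat \<Rightarrow> nat) \<Rightarrow> bool" where
  "degenerate N i \<longleftrightarrow>
     (\<exists>v\<in>V. i v = 1) \<or>
     (\<exists>j\<in>V. \<exists>l\<in>V - {j, partner j}. \<exists>s\<in>{-1, 1}. \<exists>t\<in>{-1, 0, 1}.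
        index_diff k i j + s * index_diff k i l = t * (int N - 1)) \<or>
     (\<exists>j\<in>openers. index_diff k i j = index_diff k i (partner j)) \<or>
     (\<exists>j\<in>{j \<in> openers. crossing_pair c {j, partner j}}. i (Suc j) = i (partner j))"

lemma negligible_degenerate:
  assumes "k \<ge> 1"
  shows "negligible (\<lambda>N. {i \<in> pair_tuples E N. degenerate N i})"
proof -
  have "negligible (\<lambda>N. {i \<in> solutions q N. degenerate N i})" for q
    unfolding degenerate_def
  proof (intro negligible_disj)
    show "negligible (\<lambda>N. {i \<in> solutions q N. \<exists>v\<in>V. i v = 1})"
      by (rule negligible_Bex, simp, rule negligible_index_eq[OF assms])
    show "negligible (\<lambda>N. {i \<in> solutions q N. \<exists>j\<in>V. \<exists>l\<in>V - {j, partner j}. \<exists>s\<in>{-1, 1}.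
        \<exists>t\<in>{-1, 0, 1}. index_diff k i j + s * index_diff k i l = t * (int N - 1)})"
      by (rule negligible_Bex, simp)+ (rule negligible_diff_relation[OF assms]; simp)
    show "negligible (\<lambda>N. {i \<in> solutions q N. \<exists>j\<in>openers.
        index_diff k i j = index_diff k i (partner j)})"
      by (rule negligible_Bex, simp, rule negligible_diff_eq[OF assms])
    show "negligible (\<lambda>N. {i \<in> solutions q N.
        \<exists>j\<in>{j \<in> openers. crossing_pair c {j, partner j}}. i (Suc j) = i (partner j)})"
      by (rule negligible_Bex, simp, rule negligible_crossing_coincidence[OF assms]) simp_all
  qed
  then have "negligible (\<lambda>N. \<Union>q\<in>openers \<rightarrow>\<^sub>E shifts E. {i \<in> solutions q N. degenerate N i})"
    by (intro negligible_UN finite_PiE) simp_all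
  moreover have "{i \<in> pair_tuples E N. degenerate N i}
      = (\<Union>q\<in>openers \<rightarrow>\<^sub>E shifts E. {i \<in> solutions q N. degenerate N i})" for N
    by (auto simp: pair_tuples_eq)
  ultimately show ?thesis by presburger
qed

section \<open>Matrix positions visited by a nondegenerate tuple\<close>

lemma index_range:
  assumes "i \<in> pair_tuples E N" "v \<in> V"
  shows "1 \<le> i v" "i v \<le> N"
  using assms by (auto simp: pair_tuples_def)

lemma next_vertex_in_V: "v \<in> V \<Longrightarrow> next_vertex k v \<in> V"
  by (auto simp: next_vertex_def)

lemma next_opener: "j \<in> openers \<Longrightarrow> next_vertex k j = Suc j"
  using opener_less[of j] partner_in_V[of j] opener_in_V[of j] by (auto simp: next_vertex_def)

text \<open>
  The differences strictly between the two vertices of a non-crossing pair cancel up to a multiple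
  of \<open>N - 1\<close>, so the inner indices of the pair agree unless one of them is \<open>1\<close>.
\<close>

lemma noncrossing_indices:
  assumes i: "i \<in> pair_tuples E N" and nd: "\<not> degenerate N i" and j: "j \<in> openers"
    and nc: "\<not> crossing_pair c {j, partner j}"
  shows "i (Suc j) = i (partner j)" "i j = i (next_vertex k (partner j))"
proof -
  let ?l = "partner j"
  have V': "j \<in> V" "?l \<in> V" "Suc j \<in> V" "next_vertex k ?l \<in> V"
    using j opener_in_V partner_in_V next_vertex_in_V next_opener by metis+
  have less: "j < ?l" using opener_less[OF j] .
  have rng: "2 \<le> int (i v) \<and> int (i v) \<le> int N" if "v \<in> V" for v
  proof -
    have "i v \<noteq> 1" using nd that unfolding degenerate_def by blast
    then show ?thesis using index_range[OF i that] by linarith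
  qed
  \<comment> \<open>Values in \<open>{2..N}\<close> differ by at most \<open>N - 2\<close>, so a
    difference divisible by \<open>N - 1\<close> vanishes.\<close>
  have small: "x = y" if "2 \<le> x \<and> x \<le> int N" "2 \<le> y \<and> y \<le> int N" "x - y = m * (int N - 1)" for x y m
  proof -
    have "\<bar>m * (int N - 1)\<bar> < int N - 1" using that by linarith
    moreover have "\<bar>m * (int N - 1)\<bar> = \<bar>m\<bar> * (int N - 1)" using that by (simp add: abs_mult)
    ultimately have "m = 0" using that
      by (smt (verit) mult_le_cancel_right1)
    then show ?thesis using that by simp
  qed
  obtain q where q: "i \<in> solutions q N" using i by (auto simp: pair_tuples_eq)
  have "(\<Sum>u\<in>openers. if u < Suc j \<and> Suc j \<le> partner u then params i u else 0)
      = (\<Sum>u\<in>openers. if u < ?l \<and> ?l \<le> partner u then params i u else 0)"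
  proof (rule sum.cong[OF refl])
    fix u assume u: "u \<in> openers"
    have uV: "u \<in> V" "partner u \<in> V" using u opener_in_V partner_in_V by blast+
    have nest: "\<not> (j < w \<and> w < ?l \<and> (partner w < j \<or> ?l < partner w))" if "w \<in> V" for w
      using nc crossing_pair_iff[OF j] that by blast
    have "u = j \<longleftrightarrow> partner u = ?l" "partner u \<noteq> j" "u \<noteq> ?l"
      using partner_partner[OF uV(1)] partner_partner[OF V'(1)] partner_opener_iff[OF V'(1)]
        partner_opener_iff[OF uV(1)] u j by metis+
    \<comment> \<open>Without a crossing, every other pair lies wholly inside, wholly outside or
      around the pair of \<open>j\<close>; in each case its half-open interval contains both
      \<open>Suc j\<close> and \<open>?l\<close> or neither.\<close>
    then have "u < Suc j \<and> Suc j \<le> partner u \<longleftrightarrow> u < ?l \<and> ?l \<le> partner u"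
      using nest[OF uV(1)] nest[OF uV(2)] partner_partner[OF uV(1)] less opener_less[OF u] by auto
    then show "(if u < Suc j \<and> Suc j \<le> partner u then params i u else 0)
        = (if u < ?l \<and> ?l \<le> partner u then params i u else 0)" by simp
  qed
  then have "form q N (params i) (Suc j) - form q N (params i) ?l
      = ((\<Sum>u\<in>openers. if partner u < ?l then q u else 0)
         - (\<Sum>u\<in>openers. if partner u < Suc j then q u else 0)) * (int N - 1)"
    by (simp add: form_def algebra_simps)
  then have "\<exists>m. int (i (Suc j)) - int (i ?l) = m * (int N - 1)"
    using form_params[OF q V'(3)] form_params[OF q V'(2)] by auto
  then show inner: "i (Suc j) = i ?l" using small[OF rng[OF V'(3)] rng[OF V'(2)]] by auto
  have "index_diff k i j + index_diff k i ?l = q j * (int N - 1)"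
    using q j by (simp add: solutions_def)
  then have "int (i j) - int (i (next_vertex k ?l)) = q j * (int N - 1)"
    using inner next_opener[OF j] by (simp add: index_diff_def)
  then show "i j = i (next_vertex k ?l)" using small[OF rng[OF V'(1)] rng[OF V'(4)]] by auto
qed

text \<open>The unordered matrix position read at vertex \<open>v\<close>, normalised to the upper
  triangle, where the signs are independent.\<close>

definition edge :: "(nat \<Rightarrow> nat) \<Rightarrow> nat \<Rightarrow> nat \<times> nat" where
  "edge i v = (min (i v) (i (next_vertex k v)), max (i v) (i (next_vertex k v)))"

lemma edge_eq_imp:
  assumes "edge i v = edge i w"
  shows "i v = i w \<and> i (next_vertex k v) = i (next_vertex k w)
    \<or> i v = i (next_vertex k w) \<and> i (next_vertex k v) = i w"
  using assms by (auto simp: edge_def min_def max_def split: if_splits)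

text \<open>Coinciding edges have equal or reversed index order. For a crossing pair both are
  excluded by \<open>degenerate\<close>; for a non-crossing pair \<open>noncrossing_indices\<close>
  gives the reversed coincidence.\<close>

lemma edge_partner_eq_iff:
  assumes "i \<in> pair_tuples E N" "\<not> degenerate N i" and v: "v \<in> V"
  shows "edge i v = edge i (partner v) \<longleftrightarrow> v \<notin> crossing_vertices c"
proof -
  have op: "edge i j = edge i (partner j) \<longleftrightarrow> j \<notin> crossing_vertices c" if j: "j \<in> openers" for j
  proof (cases "j \<in> crossing_vertices c")
    case True
    then have cr: "crossing_pair c {j, partner j}" by (simp add: crossing_vertices_eq)
    have "edge i j \<noteq> edge i (partner j)"
    proof
      assume "edge i j = edge i (partner j)"
      from edge_eq_imp[OF this] have "index_diff k i j = index_diff k i (partner j)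
          \<or> i (Suc j) = i (partner j)"
        using next_opener[OF j] by (auto simp: index_diff_def)
      then show False using assms(2) cr j unfolding degenerate_def by blast
    qed
    then show ?thesis using True by simp
  next
    case False
    then have "\<not> crossing_pair c {j, partner j}"
      using opener_in_V[OF j] by (simp add: crossing_vertices_eq)
    then show ?thesis
      using noncrossing_indices[OF assms(1,2) j] next_opener[OF j] False
      by (simp add: edge_def min.commute max.commute)
  qed
  show ?thesis
  proof (cases "v \<in> openers")
    case False
    then have "partner v \<in> openers" using partner_opener_iff[OF v] by blast
    from op[OF this] show ?thesis
      using partner_partner[OF v] partner_crossing_iff[OF v] by auto
  qed (rule op)
qed

lemma edge_neq:
  assumes "\<not> degenerate N i" "v \<in> V" "w \<in> V" "w \<noteq> v" "w \<noteq> partner v"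
  shows "edge i v \<noteq> edge i w"
proof
  assume "edge i v = edge i w"
  from edge_eq_imp[OF this] have "\<exists>s\<in>{-1, 1}. index_diff k i v + s * index_diff k i w = 0 * (int N - 1)"
    by (auto simp: index_diff_def)
  then show False using assms unfolding degenerate_def by blast
qed

text \<open>Different pairs never share an edge, and the two edges of a crossing pair differ. Hence
  every crossing vertex brings a sign of its own.\<close>

lemma inj_on_edge:
  assumes "i \<in> pair_tuples E N" "\<not> degenerate N i"
  shows "inj_on (edge i) (crossing_vertices c)"
proof (rule inj_onI)
  fix v w assume vw: "v \<in> crossing_vertices c" "w \<in> crossing_vertices c" "edge i v = edge i w"
  then have "v \<in> V" "w \<in> V" by (auto simp: crossing_vertices_eq)
  then show "v = w"
    using edge_neq[OF assms(2)] edge_partner_eq_iff[OF assms] vw by metis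
qed

end

section \<open>Expectations\<close>

text \<open>A canonical index for each distinct diagonal variable, so that one argument serves both
  ensembles.\<close>

fun diagonal_rep :: "ensemble \<Rightarrow> nat \<Rightarrow> nat \<Rightarrow> nat" where
  "diagonal_rep Toeplitz N s = s"
| "diagonal_rep Palindromic N s = min s (N - 1 - s)"

lemma diagonal_rep_less: "s < N \<Longrightarrow> diagonal_rep E N s < N"
  by (cases E) simp_all

lemma diagonal_rep_idem: "diagonal_rep E N (diagonal_rep E N s) = diagonal_rep E N s"
proof (cases E)
  case Palindromic
  have "min (min s t) (N - 1 - min s t) = min s t" if "t = N - 1 - s" for t
    using that by linarith
  then show ?thesis using Palindromic by simp
qed simp

text \<open>As both moduli are below \<open>N\<close>, a shift by \<open>N - 1\<close> or its
  negative forces both differences to be nonnegative or both nonpositive. Their moduli then add up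
  to \<open>N - 1\<close>, which is the palindromic reflection.\<close>

lemma diagonal_rep_opposite:
  assumes d: "\<bar>d\<bar> < int N" "\<bar>d'\<bar> < int N" "opposite_diffs E N d d'"
  shows "diagonal_rep E N (nat \<bar>d\<bar>) = diagonal_rep E N (nat \<bar>d'\<bar>)"
proof -
  obtain a a' where a: "\<bar>d\<bar> = int a" "\<bar>d'\<bar> = int a'" by (meson abs_ge_zero nonneg_int_cases)
  show ?thesis
  proof (cases E)
    case Toeplitz
    then show ?thesis using d(3) by simp
  next
    case Palindromic
    then consider "d + d' = - (int N - 1)" | "d + d' = 0" | "d + d' = int N - 1"
      using d(3) by auto
    then have "a = a' \<or> a + a' = N - 1"
    proof cases
      case 1
      then have "d = - int a" "d' = - int a'" using d(1,2) a by arith+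
      then show ?thesis using 1 by linarith
    next
      case 2
      then have "int a = int a'" using a by arith
      then show ?thesis by simp
    next
      case 3
      then have "d = int a" "d' = int a'" using d(1,2) a by arith+
      then show ?thesis using 3 by linarith
    qed
    then have "min a (N - 1 - a) = min a' (N - 1 - a')" using a d(1,2) by linarith
    then show ?thesis using Palindromic a by simp
  qed
qed

text \<open>Absolute values lose the signs, hence the \<open>s\<close>; the reflection accounts for
  the \<open>t\<close>. The conclusion is shaped to meet a clause of
  \<open>degenerate\<close>.\<close>

lemma diagonal_rep_eq_imp:
  assumes d: "\<bar>d\<bar> < int N" "\<bar>d'\<bar> < int N"
    and eq: "diagonal_rep E N (nat \<bar>d\<bar>) = diagonal_rep E N (nat \<bar>d'\<bar>)"
  shows "\<exists>s\<in>{-1, 1}. \<exists>t\<in>{-1, 0, 1}. d + s * d' = t * (int N - 1)"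
proof -
  obtain a a' where a: "\<bar>d\<bar> = int a" "\<bar>d'\<bar> = int a'" by (meson abs_ge_zero nonneg_int_cases)
  have less: "a < N" "a' < N" using d a by simp_all
  have "a = a' \<or> a + a' = N - 1"
  proof (cases E)
    case Palindromic
    then have "min a (N - 1 - a) = min a' (N - 1 - a')" using eq a by simp
    then show ?thesis using less by linarith
  qed (use eq a in simp)
  then have "int a = int a' \<or> int a + int a' = int N - 1" using less by linarith
  moreover have "d = int a \<or> d = - int a" "d' = int a' \<or> d' = - int a'" using a by arith+
  ultimately have "d - d' = 0 \<or> d + d' = 0 \<or> d + d' = int N - 1 \<or> d + d' = - (int N - 1)
      \<or> d - d' = int N - 1 \<or> d - d' = - (int N - 1)"
    by (elim disjE) simp_all
  then show ?thesis by auto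
qed

locale represented_diagonals = identically_distributed_diagonals +
  fixes E :: ensemble
  assumes b_rep: "\<lbrakk>s < N; \<omega> \<in> space M\<rbrakk> \<Longrightarrow> b s \<omega> = b (diagonal_rep E N s) \<omega>"
    and indep_reps: "indep_vars (\<lambda>_. borel) b {s. s < N \<and> diagonal_rep E N s = s}"

lemma diagonal_ensemble_represented:
  assumes "diagonal_ensemble E M N b"
  shows "represented_diagonals M N b E"
proof (cases E)
  case Toeplitz
  then interpret toeplitz_ensemble M N b using assms by simp
  have "{s. s < N \<and> diagonal_rep E N s = s} = {..<N}" using Toeplitz by auto
  then show ?thesis using Toeplitz independent_b by unfold_locales auto
next
  case Palindromic
  then interpret palindromic_ensemble M N b using assms by simp
  have "{s. s < N \<and> diagonal_rep E N s = s} = {s. s < N \<and> s \<le> N - 1 - s}"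
    using Palindromic by auto
  moreover have "b s \<omega> = b (diagonal_rep E N s) \<omega>" if "s < N" "\<omega> \<in> space M" for s \<omega>
    using palindromic_b[OF that] Palindromic by (simp add: min_def)
  ultimately show ?thesis using independent_b by unfold_locales auto
qed

section \<open>Moments of the diagonal variables\<close>

context represented_diagonals
begin

lemma expectation_square: "s < N \<Longrightarrow> expectation (\<lambda>\<omega>. b s \<omega> ^ 2) = 1"
  using variance_b[of s] mean_b[of s] by simp

lemma integrable_b: "s < N \<Longrightarrow> integrable M (b s)"
  using finite_moments_b[of s 1] by simp

text \<open>Variables with distinct representatives are independent with mean \<open>0\<close>, so
  their product has expectation \<open>0\<close>. If they agreed pointwise, it would be a square
  with expectation \<open>1\<close>.\<close>

lemma same_rv_iff:
  assumes "s < N" "t < N"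
  shows "same_rv M (b s) (b t) \<longleftrightarrow> diagonal_rep E N s = diagonal_rep E N t"
proof
  let ?s = "diagonal_rep E N s" and ?t = "diagonal_rep E N t"
  assume same: "same_rv M (b s) (b t)"
  show "?s = ?t"
  proof (rule ccontr)
    assume ne: "?s \<noteq> ?t"
    have less: "?s < N" "?t < N" using assms diagonal_rep_less by auto
    have "indep_vars (\<lambda>_. borel) b {?s, ?t}"
      by (rule indep_vars_subset[OF indep_reps]) (use less in \<open>auto simp: diagonal_rep_idem\<close>)
    then have "expectation (\<lambda>\<omega>. \<Prod>u\<in>{?s, ?t}. b u \<omega>) = (\<Prod>u\<in>{?s, ?t}. expectation (b u))"
      using less by (intro indep_vars_lebesgue_integral) (auto intro: integrable_b)
    also have "\<dots> = 0" using less ne by (simp add: mean_b)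
    also have "expectation (\<lambda>\<omega>. \<Prod>u\<in>{?s, ?t}. b u \<omega>) = expectation (\<lambda>\<omega>. b s \<omega> ^ 2)"
    proof (rule Bochner_Integration.integral_cong[OF refl])
      fix \<omega> assume w: "\<omega> \<in> space M"
      then have "b s \<omega> = b t \<omega>" using same by (simp add: same_rv_def)
      then show "(\<Prod>u\<in>{?s, ?t}. b u \<omega>) = b s \<omega> ^ 2"
        using ne b_rep[OF assms(1) w] b_rep[OF assms(2) w] by (simp add: power2_eq_square)
    qed
    also have "\<dots> = 1" by (rule expectation_square[OF assms(1)])
    finally show False by simp
  qed
next
  assume "diagonal_rep E N s = diagonal_rep E N t"
  then show "same_rv M (b s) (b t)" using assms b_rep by (simp add: same_rv_def)
qed

lemma squares_product:
  assumes "R \<subseteq> {s. s < N \<and> diagonal_rep E N s = s}"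
  shows integrable_prod_squares: "integrable M (\<lambda>\<omega>. \<Prod>r\<in>R. b r \<omega> ^ 2)"
    and expectation_prod_squares: "expectation (\<lambda>\<omega>. \<Prod>r\<in>R. b r \<omega> ^ 2) = 1"
proof -
  have fin: "finite R" using assms by (rule finite_subset) simp
  have ind: "indep_vars (\<lambda>_. borel) (\<lambda>r \<omega>. b r \<omega> ^ 2) R"
    by (rule indep_vars_compose2[OF indep_vars_subset[OF indep_reps assms]]) simp
  have int: "integrable M (\<lambda>\<omega>. b r \<omega> ^ 2)" if "r \<in> R" for r
    using that assms by (intro finite_moments_b) auto
  show "integrable M (\<lambda>\<omega>. \<Prod>r\<in>R. b r \<omega> ^ 2)"
    by (rule indep_vars_integrable[OF fin ind int])
  have "expectation (\<lambda>\<omega>. \<Prod>r\<in>R. b r \<omega> ^ 2) = (\<Prod>r\<in>R. expectation (\<lambda>\<omega>. b r \<omega> ^ 2))"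
    by (rule indep_vars_lebesgue_integral[OF fin ind int])
  also have "\<dots> = 1" using assms by (intro prod.neutral) (auto intro: expectation_square)
  finally show "expectation (\<lambda>\<omega>. \<Prod>r\<in>R. b r \<omega> ^ 2) = 1" .
qed

end

section \<open>Expectations of products of signs\<close>

context random_signs
begin

abbreviation upper :: "(nat \<times> nat) set" where
  "upper \<equiv> {(i, j). 1 \<le> i \<and> i \<le> j \<and> j \<le> N}"

lemma sign_measurable: "e \<in> upper \<Longrightarrow> random_variable borel (case e of (i, j) \<Rightarrow> \<epsilon> i j)"
  using signs_independent unfolding indep_vars_def by blast

lemma sign_pm:
  assumes "e \<in> upper" "\<omega> \<in> space M"
  shows "(case e of (i, j) \<Rightarrow> \<epsilon> i j) \<omega> = 1 \<or> (case e of (i, j) \<Rightarrow> \<epsilon> i j) \<omega> = -1"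
proof -
  obtain i j where e: "e = (i, j)" by fastforce
  then have "\<epsilon> i j \<omega> \<in> {1, -1}" using assms by (intro sign_values) simp_all
  then show ?thesis using e by simp
qed

lemma integrable_sign: "e \<in> upper \<Longrightarrow> integrable M (case e of (i, j) \<Rightarrow> \<epsilon> i j)"
proof (rule integrable_const_bound[where B = 1])
  assume e: "e \<in> upper"
  show "AE \<omega> in M. norm ((case e of (i, j) \<Rightarrow> \<epsilon> i j) \<omega>) \<le> 1"
    using sign_pm[OF e] by (intro AE_I2) fastforce
qed (rule sign_measurable)

lemma expectation_sign:
  assumes e: "e \<in> upper"
  shows "expectation (case e of (i, j) \<Rightarrow> \<epsilon> i j) = 2 * p - 1"
proof -
  define X where "X = (case e of (i, j) \<Rightarrow> \<epsilon> i j)"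
  have meas: "random_variable borel X" unfolding X_def by (rule sign_measurable[OF e])
  define S where "S = {\<omega> \<in> space M. X \<omega> = 1}"
  have S: "S \<in> events" unfolding S_def using meas by measurable
  have "prob S = p"
    using e sign_prob[of "fst e" "snd e"] by (auto simp: S_def X_def split: prod.splits)
  have "expectation X = expectation (\<lambda>\<omega>. 2 * indicator S \<omega> - 1)"
    by (rule Bochner_Integration.integral_cong[OF refl])
       (use sign_pm[OF e] in \<open>auto simp: X_def[symmetric] S_def indicator_def\<close>)
  also have "\<dots> = 2 * prob S - 1"
  proof -
    have "integrable M (indicat_real S)"
      using S by (intro integrable_real_indicator) (auto simp: emeasure_eq_measure)
    then show ?thesis
      using S by (subst Bochner_Integration.integral_diff) (auto simp: prob_space)
  qed
  finally show ?thesis using \<open>prob S = p\<close> by (simp add: X_def)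
qed

lemma expectation_prod_distinct_signs:
  assumes "D \<subseteq> upper"
  shows "expectation (\<lambda>\<omega>. \<Prod>e\<in>D. (case e of (i, j) \<Rightarrow> \<epsilon> i j) \<omega>) = (2 * p - 1) ^ card D"
proof -
  have "upper \<subseteq> {1..N} \<times> {1..N}" by auto
  then have fin: "finite D" using assms by (meson finite_SigmaI finite_atLeastAtMost finite_subset)
  have "expectation (\<lambda>\<omega>. \<Prod>e\<in>D. (case e of (i, j) \<Rightarrow> \<epsilon> i j) \<omega>)
      = (\<Prod>e\<in>D. expectation (case e of (i, j) \<Rightarrow> \<epsilon> i j))"
    by (rule indep_vars_lebesgue_integral[OF fin indep_vars_subset[OF signs_independent assms]])
       (use assms integrable_sign in blast)
  also have "\<dots> = (\<Prod>e\<in>D. 2 * p - 1)"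
    by (rule prod.cong) (use assms expectation_sign in blast)+
  finally show ?thesis by simp
qed

text \<open>Both products are measurable functions of the two families assumed independent. The sign
  family has only ordered index pairs, so symmetry first moves each sign to the upper triangle. The
  second claim serves for tuples whose sign pattern is not computed.\<close>

lemma expectation_signed_prod:
  assumes "finite V" and u: "\<And>v. v \<in> V \<Longrightarrow> u v \<in> {1..N}" and w: "\<And>v. v \<in> V \<Longrightarrow> w v \<in> {1..N}"
    and intA: "integrable M (\<lambda>\<omega>. \<Prod>v\<in>V. A (u v) (w v) \<omega>)"
  shows "expectation (\<lambda>\<omega>. \<Prod>v\<in>V. signed_matrix \<epsilon> A (u v) (w v) \<omega>)
     = expectation (\<lambda>\<omega>. \<Prod>v\<in>V. (case (min (u v) (w v), max (u v) (w v)) of (i, j) \<Rightarrow> \<epsilon> i j) \<omega>)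
       * expectation (\<lambda>\<omega>. \<Prod>v\<in>V. A (u v) (w v) \<omega>)"
    and "\<bar>expectation (\<lambda>\<omega>. \<Prod>v\<in>V. (case (min (u v) (w v), max (u v) (w v)) of (i, j) \<Rightarrow> \<epsilon> i j) \<omega>)\<bar> \<le> 1"
proof -
  define e where "e v = (min (u v) (w v), max (u v) (w v))" for v
  define f :: "(nat \<times> nat \<Rightarrow> real) \<Rightarrow> real" where "f = (\<lambda>x. \<Prod>v\<in>V. x (e v))"
  define g :: "(nat \<times> nat \<Rightarrow> real) \<Rightarrow> real" where "g = (\<lambda>x. \<Prod>v\<in>V. x (u v, w v))"
  define X where "X = (\<lambda>\<omega>. \<Prod>v\<in>V. (case e v of (i, j) \<Rightarrow> \<epsilon> i j) \<omega>)"
  define Y where "Y = (\<lambda>\<omega>. \<Prod>v\<in>V. A (u v) (w v) \<omega>)"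
  have e: "e v \<in> upper" if "v \<in> V" for v using u[OF that] w[OF that] by (auto simp: e_def)
  have f: "f \<in> borel_measurable (Pi\<^sub>M upper (\<lambda>_. borel))"
    unfolding f_def by (intro borel_measurable_prod measurable_component_singleton e)
  have g: "g \<in> borel_measurable (Pi\<^sub>M ({1..N} \<times> {1..N}) (\<lambda>_. borel))"
    unfolding g_def using u w by (intro borel_measurable_prod measurable_component_singleton) blast
  have fX: "f \<circ> (\<lambda>\<omega>. restrict (\<lambda>(i, j). \<epsilon> i j \<omega>) upper) = X"
  proof
    fix \<omega>
    show "(f \<circ> (\<lambda>\<omega>. restrict (\<lambda>(i, j). \<epsilon> i j \<omega>) upper)) \<omega> = X \<omega>"
      unfolding f_def X_def comp_def
    proof (rule prod.cong[OF refl])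
      fix v assume "v \<in> V"
      then show "restrict (\<lambda>(i, j). \<epsilon> i j \<omega>) upper (e v) = (case e v of (i, j) \<Rightarrow> \<epsilon> i j) \<omega>"
        unfolding restrict_apply'[OF e[OF \<open>v \<in> V\<close>]] by (simp split: prod.split)
    qed
  qed
  have gY: "g \<circ> (\<lambda>\<omega>. restrict (\<lambda>(i, j). A i j \<omega>) ({1..N} \<times> {1..N})) = Y"
  proof
    fix \<omega>
    show "(g \<circ> (\<lambda>\<omega>. restrict (\<lambda>(i, j). A i j \<omega>) ({1..N} \<times> {1..N}))) \<omega> = Y \<omega>"
      unfolding g_def Y_def comp_def by (rule prod.cong[OF refl]) (use u w in auto)
  qed
  have ind: "indep_var borel X borel Y"
    using indep_var_compose[OF signs_independent_of_matrix f g] unfolding fX gY .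
  have abs: "\<bar>X \<omega>\<bar> = 1" if "\<omega> \<in> space M" for \<omega>
    unfolding X_def abs_prod using sign_pm[OF e that] by (intro prod.neutral) fastforce
  have intX: "integrable M X"
    using abs by (intro integrable_const_bound[where B = 1] AE_I2 indep_var_rv1[OF ind]) simp
  have "expectation (\<lambda>\<omega>. \<Prod>v\<in>V. signed_matrix \<epsilon> A (u v) (w v) \<omega>) = expectation (\<lambda>\<omega>. X \<omega> * Y \<omega>)"
  proof (rule Bochner_Integration.integral_cong[OF refl])
    fix \<omega> assume "\<omega> \<in> space M"
    then have "\<epsilon> (u v) (w v) \<omega> = (case e v of (i, j) \<Rightarrow> \<epsilon> i j) \<omega>" if "v \<in> V" for v
      using sign_symmetric[OF u[OF that] w[OF that]] by (simp add: e_def min_def max_def)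
    then show "(\<Prod>v\<in>V. signed_matrix \<epsilon> A (u v) (w v) \<omega>) = X \<omega> * Y \<omega>"
      unfolding signed_matrix_def X_def Y_def by (simp add: prod.distrib)
  qed
  also have "\<dots> = expectation X * expectation Y"
    by (rule indep_var_lebesgue_integral[OF ind intX]) (use intA in \<open>simp add: Y_def\<close>)
  finally show "expectation (\<lambda>\<omega>. \<Prod>v\<in>V. signed_matrix \<epsilon> A (u v) (w v) \<omega>)
     = expectation (\<lambda>\<omega>. \<Prod>v\<in>V. (case (min (u v) (w v), max (u v) (w v)) of (i, j) \<Rightarrow> \<epsilon> i j) \<omega>)
       * expectation (\<lambda>\<omega>. \<Prod>v\<in>V. A (u v) (w v) \<omega>)"
    by (simp add: X_def Y_def e_def)
  have "\<bar>expectation X\<bar> \<le> expectation (\<lambda>\<omega>. \<bar>X \<omega>\<bar>)" by (rule integral_abs_bound)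
  also have "\<dots> = expectation (\<lambda>\<omega>. 1)"
    by (rule Bochner_Integration.integral_cong[OF refl]) (rule abs)
  finally show "\<bar>expectation (\<lambda>\<omega>. \<Prod>v\<in>V. (case (min (u v) (w v), max (u v) (w v)) of (i, j) \<Rightarrow> \<epsilon> i j) \<omega>)\<bar> \<le> 1"
    by (simp add: X_def e_def prob_space)
qed

end

section \<open>Expectations along the tuples of a pairing\<close>

context pairing
begin

lemma index_diff_bound:
  assumes "i \<in> pair_tuples E N" "v \<in> V"
  shows "\<bar>index_diff k i v\<bar> < int N"
  using index_range[OF assms] index_range[OF assms(1) next_vertex_in_V[OF assms(2)]]
  unfolding index_diff_def by linarith

lemma pairing_tuples_subset: "pairing_tuples E M b k c N \<subseteq> pair_tuples E N"
proof
  fix i assume i: "i \<in> pairing_tuples E M b k c N"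
  then have "opposite_diffs E N (index_diff k i j) (index_diff k i (partner j))" if "j \<in> openers" for j
    using pair_partner[OF opener_in_V[OF that]] by (simp add: pairing_tuples_def)
  then show "i \<in> pair_tuples E N" using i by (simp add: pairing_tuples_def pair_tuples_def)
qed

lemma opposite_diffs_sym: "opposite_diffs E N d d' \<Longrightarrow> opposite_diffs E N d' d"
  by (simp add: opposite_diffs_iff add.commute)

lemma opposite_diffs_pair:
  assumes "i \<in> pair_tuples E N" "{j, l} \<in> c"
  shows "opposite_diffs E N (index_diff k i j) (index_diff k i l)"
proof -
  have j: "j \<in> V" "l = partner j" using assms(2) pair_iff by auto
  show ?thesis
  proof (cases "j \<in> openers")
    case False
    then have "partner j \<in> openers" using partner_opener_iff[OF j(1)] by blast
    then have "opposite_diffs E N (index_diff k i (partner j)) (index_diff k i (partner (partner j)))"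
      using assms(1) by (simp add: pair_tuples_def)
    then show ?thesis unfolding partner_partner[OF j(1)] j(2) by (rule opposite_diffs_sym)
  qed (use assms(1) j in \<open>simp add: pair_tuples_def\<close>)
qed

text \<open>Equal variables at different pairs would give a relation excluded by
  \<open>degenerate\<close>, and within a pair the pair equation forces equality.\<close>

lemma nondegenerate_in_pairing_tuples:
  assumes "represented_diagonals M N b E"
    and i: "i \<in> pair_tuples E N" and nd: "\<not> degenerate N i"
  shows "i \<in> pairing_tuples E M b k c N"
proof -
  interpret represented_diagonals M N b E by fact
  have "same_rv M (b (nat \<bar>index_diff k i j\<bar>)) (b (nat \<bar>index_diff k i l\<bar>)) \<longleftrightarrow> {j, l} \<in> c"
    if j: "j \<in> V" and l: "l \<in> V" and "j \<noteq> l" for j l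
  proof -
    have less: "nat \<bar>index_diff k i j\<bar> < N" "nat \<bar>index_diff k i l\<bar> < N"
      using index_diff_bound[OF i j] index_diff_bound[OF i l] by linarith+
    show ?thesis
      unfolding same_rv_iff[OF less]
    proof
      assume "diagonal_rep E N (nat \<bar>index_diff k i j\<bar>) = diagonal_rep E N (nat \<bar>index_diff k i l\<bar>)"
      from diagonal_rep_eq_imp[OF index_diff_bound[OF i j] index_diff_bound[OF i l] this]
      have "\<not> l \<in> V - {j, partner j}" using nd j unfolding degenerate_def by blast
      then show "{j, l} \<in> c" using l \<open>j \<noteq> l\<close> pair_partner[OF j] by auto
    next
      assume "{j, l} \<in> c"
      then show "diagonal_rep E N (nat \<bar>index_diff k i j\<bar>) = diagonal_rep E N (nat \<bar>index_diff k i l\<bar>)"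
        using diagonal_rep_opposite[OF index_diff_bound[OF i j] index_diff_bound[OF i l]]
          opposite_diffs_pair[OF i] by blast
    qed
  qed
  then show ?thesis
    using i opposite_diffs_pair[OF i] unfolding pairing_tuples_def pair_tuples_def by blast
qed

text \<open>The \<open>same_rv\<close> condition makes the representatives of the openers distinct
  and those within a pair equal, leaving a product of independent squares of mean \<open>1\<close>.
  This covers the degenerate tuples in \<open>pairing_tuples\<close> as well.\<close>

lemma unsigned_expectation:
  assumes "represented_diagonals M N b E" and i: "i \<in> pairing_tuples E M b k c N"
  shows "integrable M (\<lambda>\<omega>. \<Prod>v\<in>V. toeplitz_matrix b (i v) (i (next_vertex k v)) \<omega>)" (is ?I)
    and "(\<integral>\<omega>. (\<Prod>v\<in>V. toeplitz_matrix b (i v) (i (next_vertex k v)) \<omega>) \<partial>M) = 1" (is ?E)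
proof -
  interpret represented_diagonals M N b E by fact
  have ip: "i \<in> pair_tuples E N" by (rule subsetD[OF pairing_tuples_subset i])
  define s where "s v = nat \<bar>index_diff k i v\<bar>" for v
  define r where "r v = diagonal_rep E N (s v)" for v
  have less: "s v < N" if "v \<in> V" for v
    using index_diff_bound[OF ip that] unfolding s_def by linarith
  have same: "r v = r w \<longleftrightarrow> {v, w} \<in> c" if "v \<in> V" "w \<in> V" "v \<noteq> w" for v w
    using i that same_rv_iff[OF less[OF that(1)] less[OF that(2)]]
    unfolding pairing_tuples_def r_def s_def by blast
  have inj: "inj_on r openers"
  proof (rule inj_onI)
    fix v w assume vw: "v \<in> openers" "w \<in> openers" "r v = r w"
    show "v = w"
    proof (rule ccontr)
      assume "v \<noteq> w"
      then have "{v, w} \<in> c" using same[OF opener_in_V opener_in_V] vw by blast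
      then have "w = partner v" using pair_iff by blast
      then show False using vw(1,2) partner_opener_iff[OF opener_in_V[OF vw(1)]] by blast
    qed
  qed
  have prod: "(\<Prod>v\<in>V. toeplitz_matrix b (i v) (i (next_vertex k v)) \<omega>) = (\<Prod>t\<in>r ` openers. b t \<omega> ^ 2)"
    if w: "\<omega> \<in> space M" for \<omega>
  proof -
    have "(\<Prod>v\<in>V. toeplitz_matrix b (i v) (i (next_vertex k v)) \<omega>) = (\<Prod>v\<in>V. b (r v) \<omega>)"
    proof (rule prod.cong[OF refl])
      fix v assume "v \<in> V"
      from b_rep[OF less[OF this] w]
      show "toeplitz_matrix b (i v) (i (next_vertex k v)) \<omega> = b (r v) \<omega>"
        by (simp add: toeplitz_matrix_def r_def s_def index_diff_def)
    qed
    also have "\<dots> = (\<Prod>v\<in>openers. b (r v) \<omega> ^ 2)"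
      unfolding prod_V
    proof (rule prod.cong[OF refl])
      fix v assume "v \<in> openers"
      then have v: "v \<in> V" by (rule opener_in_V)
      have "r v = r (partner v)"
        using same[OF v partner_in_V[OF v]] partner_neq[OF v] pair_partner[OF v] by metis
      then show "b (r v) \<omega> * b (r (partner v)) \<omega> = b (r v) \<omega> ^ 2" by (simp add: power2_eq_square)
    qed
    finally show ?thesis by (simp add: prod.reindex[OF inj])
  qed
  have sub: "r ` openers \<subseteq> {s. s < N \<and> diagonal_rep E N s = s}"
    using less opener_in_V by (auto simp: r_def diagonal_rep_idem intro!: diagonal_rep_less
        simp del: atLeastAtMost_iff)
  have "?I \<longleftrightarrow> integrable M (\<lambda>\<omega>. \<Prod>t\<in>r ` openers. b t \<omega> ^ 2)"
    by (rule Bochner_Integration.integrable_cong[OF refl]) (rule prod)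
  then show ?I using integrable_prod_squares[OF sub] by simp
  have "expectation (\<lambda>\<omega>. \<Prod>v\<in>V. toeplitz_matrix b (i v) (i (next_vertex k v)) \<omega>)
      = expectation (\<lambda>\<omega>. \<Prod>t\<in>r ` openers. b t \<omega> ^ 2)"
    by (rule Bochner_Integration.integral_cong[OF refl]) (rule prod)
  then show ?E using expectation_prod_squares[OF sub] by simp
qed

text \<open>Since the matrix factor has expectation \<open>1\<close>, only signs remain. On
  degenerate tuples their pattern is unknown, and the bound stands in for the value.\<close>

lemma signed_expectation:
  assumes rd: "represented_diagonals M N b E" and rs: "random_signs M N (toeplitz_matrix b) p \<epsilon>"
    and i: "i \<in> pairing_tuples E M b k c N"
  defines "S \<equiv> \<integral>\<omega>. (\<Prod>v\<in>V. signed_matrix \<epsilon> (toeplitz_matrix b) (i v) (i (next_vertex k v)) \<omega>) \<partial>M"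
  shows "\<bar>S\<bar> \<le> 1" (is ?bound)
    and "\<not> degenerate N i \<Longrightarrow> S = (2 * p - 1) ^ card (crossing_vertices c)" (is "_ \<Longrightarrow> ?value")
proof -
  interpret random_signs M N "toeplitz_matrix b" p \<epsilon> by fact
  have ip: "i \<in> pair_tuples E N" by (rule subsetD[OF pairing_tuples_subset i])
  have rng: "i v \<in> {1..N}" if "v \<in> V" for v using index_range[OF ip that] by simp
  define sgn' where "sgn' v = (case edge i v of (a, d) \<Rightarrow> \<epsilon> a d)" for v
  have "S = expectation (\<lambda>\<omega>. \<Prod>v\<in>V. sgn' v \<omega>)" and bound: "\<bar>expectation (\<lambda>\<omega>. \<Prod>v\<in>V. sgn' v \<omega>)\<bar> \<le> 1"
    using expectation_signed_prod[of V i "\<lambda>v. i (next_vertex k v)", OF _ rng rng[OF next_vertex_in_V]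
        unsigned_expectation(1)[OF rd i]] unsigned_expectation(2)[OF rd i]
    unfolding S_def sgn'_def edge_def by (simp_all del: atLeastAtMost_iff)
  then show ?bound by simp
  assume nd: "\<not> degenerate N i"
  let ?C = "crossing_vertices c"
  have CV: "?C \<subseteq> V" by (auto simp: crossing_vertices_eq)
  have up: "edge i v \<in> upper" if "v \<in> V" for v
    using rng[OF that] rng[OF next_vertex_in_V[OF that]] by (auto simp: edge_def)
  have "(\<Prod>v\<in>V. sgn' v \<omega>) = (\<Prod>e\<in>edge i ` ?C. (case e of (a, d) \<Rightarrow> \<epsilon> a d) \<omega>)"
    if w: "\<omega> \<in> space M" for \<omega>
  proof -
    have "(\<Prod>v\<in>V. sgn' v \<omega>) = (\<Prod>v\<in>V. if v \<in> ?C then sgn' v \<omega> else 1) * (\<Prod>v\<in>V. if v \<in> ?C then 1 else sgn' v \<omega>)"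
      unfolding prod.distrib[symmetric] by (rule prod.cong) auto
    \<comment> \<open>The vertices outside \<open>?C\<close> come in whole pairs, and both vertices
      of such a pair read the same sign, whose square is \<open>1\<close>.\<close>
    also have "(\<Prod>v\<in>V. if v \<in> ?C then 1 else sgn' v \<omega>) = 1"
      unfolding prod_V
    proof (rule prod.neutral, rule ballI)
      fix v assume "v \<in> openers"
      then have v: "v \<in> V" by (rule opener_in_V)
      show "(if v \<in> ?C then 1 else sgn' v \<omega>) * (if partner v \<in> ?C then 1 else sgn' (partner v) \<omega>) = 1"
      proof (cases "v \<in> ?C")
        case False
        then have "sgn' v = sgn' (partner v)"
          using edge_partner_eq_iff[OF ip nd v] by (simp add: sgn'_def)
        moreover have "sgn' v \<omega> = 1 \<or> sgn' v \<omega> = -1"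
          unfolding sgn'_def by (rule sign_pm[OF up[OF v] w])
        ultimately show ?thesis using False partner_crossing_iff[OF v] by auto
      qed (use partner_crossing_iff[OF v] in simp)
    qed
    also have "(\<Prod>v\<in>V. if v \<in> ?C then sgn' v \<omega> else 1) = (\<Prod>v\<in>?C. sgn' v \<omega>)"
      using CV by (simp add: prod.inter_restrict[symmetric] Int_absorb1)
    also have "\<dots> = (\<Prod>e\<in>edge i ` ?C. (case e of (a, d) \<Rightarrow> \<epsilon> a d) \<omega>)"
      by (simp add: prod.reindex[OF inj_on_edge[OF ip nd]] sgn'_def)
    finally show ?thesis by simp
  qed
  then have "expectation (\<lambda>\<omega>. \<Prod>v\<in>V. sgn' v \<omega>)
      = expectation (\<lambda>\<omega>. \<Prod>e\<in>edge i ` ?C. (case e of (a, d) \<Rightarrow> \<epsilon> a d) \<omega>)"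
    by (rule Bochner_Integration.integral_cong[OF refl])
  also have "\<dots> = (2 * p - 1) ^ card (edge i ` ?C)"
    by (intro expectation_prod_distinct_signs image_subsetI up subsetD[OF CV])
  also have "card (edge i ` ?C) = card ?C" by (rule card_image[OF inj_on_edge[OF ip nd]])
  finally show ?value using \<open>S = _\<close> by simp
qed

text \<open>\<open>T N\<close> lies between the nondegenerate tuples and all of
  \<open>pair_tuples\<close>, so replacing the sum by \<open>y\<close> times the full count costs at
  most \<open>2\<close> per degenerate tuple, one each for \<open>g\<close> and
  \<open>y\<close>.\<close>

lemma normalised_limit:
  fixes g :: "nat \<Rightarrow> (nat \<Rightarrow> nat) \<Rightarrow> real"
  assumes "k \<ge> 1"
    and x: "(\<lambda>N. real (card (pair_tuples E N)) / real N ^ (k + 1)) \<longlonglongrightarrow> x"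
    and T: "\<And>N. N \<ge> 1 \<Longrightarrow> T N \<subseteq> pair_tuples E N"
      "\<And>N i. \<lbrakk>N \<ge> 1; i \<in> pair_tuples E N; \<not> degenerate N i\<rbrakk> \<Longrightarrow> i \<in> T N"
    and g: "\<And>N i. \<lbrakk>N \<ge> 1; i \<in> T N\<rbrakk> \<Longrightarrow> \<bar>g N i\<bar> \<le> 1"
      "\<And>N i. \<lbrakk>N \<ge> 1; i \<in> T N; \<not> degenerate N i\<rbrakk> \<Longrightarrow> g N i = y"
    and y: "\<bar>y\<bar> \<le> 1"
  shows "(\<lambda>N. (\<Sum>i\<in>T N. g N i) / real N ^ (k + 1)) \<longlonglongrightarrow> x * y"
proof -
  define D where "D N = {i \<in> pair_tuples E N. degenerate N i}" for N
  have D: "(\<lambda>N. real (card (D N)) / real N ^ (k + 1)) \<longlonglongrightarrow> 0"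
    unfolding D_def by (rule negligible_card_tendsto[OF negligible_degenerate[OF assms(1)]])
  have err: "\<bar>(\<Sum>i\<in>T N. g N i) - real (card (pair_tuples E N)) * y\<bar> \<le> 2 * real (card (D N))"
    if N: "N \<ge> 1" for N
  proof -
    define h where "h i = (if i \<in> T N then g N i else 0) - y" for i
    have "(\<Sum>i\<in>T N. g N i) = (\<Sum>i\<in>pair_tuples E N. if i \<in> T N then g N i else 0)"
      using T(1)[OF N] by (simp add: sum.inter_restrict[symmetric] Int_absorb1)
    then have "(\<Sum>i\<in>T N. g N i) - real (card (pair_tuples E N)) * y = (\<Sum>i\<in>pair_tuples E N. h i)"
      by (simp add: h_def sum_subtractf)
    also have "\<dots> = (\<Sum>i\<in>D N. h i)"
      by (rule sum.mono_neutral_right) (use T(2)[OF N] g(2)[OF N] in \<open>auto simp: D_def h_def\<close>)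
    also have "\<bar>\<dots>\<bar> \<le> (\<Sum>i\<in>D N. \<bar>h i\<bar>)" by (rule sum_abs)
    also have "\<dots> \<le> (\<Sum>i\<in>D N. 2)"
    proof (rule sum_mono)
      fix i show "\<bar>h i\<bar> \<le> 2" using g(1)[OF N, of i] y by (auto simp: h_def)
    qed
    finally show ?thesis by simp
  qed
  have "(\<lambda>N. (\<Sum>i\<in>T N. g N i) / real N ^ (k + 1) - real (card (pair_tuples E N)) / real N ^ (k + 1) * y) \<longlonglongrightarrow> 0"
  proof (rule Lim_null_comparison)
    show "\<forall>\<^sub>F N in sequentially.
        norm ((\<Sum>i\<in>T N. g N i) / real N ^ (k + 1) - real (card (pair_tuples E N)) / real N ^ (k + 1) * y)
        \<le> 2 * (real (card (D N)) / real N ^ (k + 1))"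
    proof (rule eventually_sequentiallyI[of 1])
      fix N :: nat assume N: "1 \<le> N"
      have "(\<Sum>i\<in>T N. g N i) / real N ^ (k + 1) - real (card (pair_tuples E N)) / real N ^ (k + 1) * y
          = ((\<Sum>i\<in>T N. g N i) - real (card (pair_tuples E N)) * y) / real N ^ (k + 1)"
        by (simp add: diff_divide_distrib)
      then show "norm ((\<Sum>i\<in>T N. g N i) / real N ^ (k + 1) - real (card (pair_tuples E N)) / real N ^ (k + 1) * y)
        \<le> 2 * (real (card (D N)) / real N ^ (k + 1))"
        using divide_right_mono[OF err[OF N], of "real N ^ (k + 1)"] by (simp add: abs_divide)
    qed
    show "(\<lambda>N. 2 * (real (card (D N)) / real N ^ (k + 1))) \<longlonglongrightarrow> 0"
      using tendsto_mult_left[OF D, of 2] by simp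
  qed
  from tendsto_add[OF this tendsto_mult_right[OF x, of y]] show ?thesis by simp
qed

end

theorem theorem3p4:
  fixes E :: ensemble
    and M :: "nat \<Rightarrow> 'a measure"
    and b :: "nat \<Rightarrow> nat \<Rightarrow> 'a \<Rightarrow> real"
    and \<epsilon> :: "nat \<Rightarrow> nat \<Rightarrow> nat \<Rightarrow> 'a \<Rightarrow> real"
    and p :: real and k :: nat and c :: "nat set set"
  assumes "1/2 \<le> p" and "p \<le> 1" and "k \<ge> 1"
    and "\<And>N. N \<ge> 1 \<Longrightarrow> diagonal_ensemble E (M N) N (b N)"
    and "\<And>N. N \<ge> 1 \<Longrightarrow> random_signs (M N) N (toeplitz_matrix (b N)) p (\<epsilon> N)"
    and "is_pairing k c"
  shows "\<exists>x. has_unsigned_contribution E M b k c x \<and>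
             has_signed_contribution E M b \<epsilon> k c
               (x * (2 * p - 1) ^ card (crossing_vertices c))"
proof -
  interpret pairing k c using assms(6) by unfold_locales
  have rd: "represented_diagonals (M N) N (b N) E" if "N \<ge> 1" for N
    by (rule diagonal_ensemble_represented[OF assms(4)[OF that]])
  \<comment> \<open>This limit involves only \<open>E\<close>, \<open>k\<close> and
    \<open>c\<close>, so it serves for both contributions.\<close>
  obtain x where x: "(\<lambda>N. real (card (pair_tuples E N)) / real N ^ (k + 1)) \<longlonglongrightarrow> x"
    using convergent_card_pair_tuples[OF assms(3)] unfolding convergent_def by blast
  have "\<bar>(2 * p - 1) ^ card (crossing_vertices c)\<bar> \<le> 1"
    using assms(1,2) by (simp add: power_abs power_le_one)
  then have "has_signed_contribution E M b \<epsilon> k c (x * (2 * p - 1) ^ card (crossing_vertices c))"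
    unfolding has_signed_contribution_def normalised_sum_def
    using pairing_tuples_subset nondegenerate_in_pairing_tuples[OF rd]
      signed_expectation[OF rd assms(5)]
    by (intro normalised_limit[OF assms(3) x])
  \<comment> \<open>The unsigned sum is the instance with constant value \<open>1\<close>.\<close>
  moreover have "has_unsigned_contribution E M b k c (x * 1)"
    unfolding has_unsigned_contribution_def normalised_sum_def
  proof (rule normalised_limit[OF assms(3) x])
    fix N i assume "1 \<le> N" "i \<in> pairing_tuples E (M N) (b N) k c N"
    from unsigned_expectation(2)[OF rd[OF this(1)] this(2)]
    show "(\<integral>\<omega>. (\<Prod>v\<in>V. toeplitz_matrix (b N) (i v) (i (next_vertex k v)) \<omega>) \<partial>M N) = 1"
      and "\<bar>\<integral>\<omega>. (\<Prod>v\<in>V. toeplitz_matrix (b N) (i v) (i (next_vertex k v)) \<omega>) \<partial>M N\<bar> \<le> 1"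
      by simp_all
  qed (use pairing_tuples_subset nondegenerate_in_pairing_tuples[OF rd] in simp_all)
  ultimately show ?thesis by auto
qed

end
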